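(* Let $U=-V:\mathbb{R}^n\to(0,\infty]$ be continuous, and smooth away from its collision points (the points where $U=\infty$). If the Marchal lemma holds for the potential $V$, then the JM-Marchal lemma holds for $V$ at energy $0$.
   Context: Setting. Configuration space is a Euclidean vector space $\mathbb{R}^n$ with a potential $V=-U$, where $U:\mathbb{R}^n\to(0,\infty]$ is continuous. A collision point is a point $p\in\mathbb{R}^n$ with $U(p)=\infty$; $U$ is smooth away from collision points. The Lagrangian is $L(q,\dot q)=\frac12|\dot q|^2+U(q)$, and the action of an absolutely continuous path $c$ is $A(c)=\int_c L\,dt\in[0,\infty]$. An interior collision point of a path is a collision point along the path which is not one of the path's endpoints. Fixed endpoint, fixed time action minimization problem: given $q_0,q_1\in\mathbb{R}^n$ and $T>0$, minimize $\int_c L\,dt$ over all (absolutely continuous) paths $c$ joining $q_0$ to $q_1$ in time $T$. A minimizer is understood to have finite action. The Marchal lemma holds for $V$ if, for every choice of $q_0,q_1\in\mathbb{R}^n$ and $T>0$, every minimizer of the fixed endpoint, fixed time action minimization problem has no interior collision points. Jacobi-Maupertuis (JM) length. For an energy $h_0\in\mathbb{R}$ the Hill region is $\{q: h_0+U(q)\ge 0\}$ (all of $\mathbb{R}^n$ when $h_0=0$). The JM length at energy $h_0$ of an absolutely continuous curve $c$ in the Hill region is $\ell(c)=\int_c\sqrt{2(h_0+U(q))}\,|dq|\in[0,\infty]$. A curve $c$ in the Hill region joining $p$ to $q$ is a minimizing JM geodesic for energy $h_0$ if $\ell(c)<\infty$ and $\ell(c)\le\ell(\sigma)$ for every absolutely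 continuous curve $\sigma$ in the Hill region joining $p$ to $q$. The JM-Marchal lemma holds for $V$ at energy $h_0$ if no minimizing JM geodesic for energy $h_0$ has an interior collision point. *)

theory Defs
  imports "HOL-Analysis.Analysis"
begin

definition collision_point :: "('a \<Rightarrow> ereal) \<Rightarrow> 'a \<Rightarrow> bool" where
  "collision_point U p \<longleftrightarrow> U p = \<infinity>"

(* k times continuously differentiable; only meant for open S *)
fun Ck_on :: "'a::real_normed_vector set \<Rightarrow> ('a \<Rightarrow> 'b::real_normed_vector) \<Rightarrow> nat \<Rightarrow> bool" where
  "Ck_on S f 0 \<longleftrightarrow> continuous_on S f"
| "Ck_on S f (Suc k) \<longleftrightarrow>
     (\<forall>x\<in>S. f differentiable (at x)) \<and> (\<forall>v. Ck_on S (\<lambda>x. frechet_derivative f (at x) v) k)"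

definition smooth_on :: "'a::real_normed_vector set \<Rightarrow> ('a \<Rightarrow> 'b::real_normed_vector) \<Rightarrow> bool" where
  "smooth_on S f \<longleftrightarrow> (\<forall>k. Ck_on S f k)"

(* D is a finite family of pairwise non-overlapping subintervals, each given by its endpoints;
   degenerate members (x, x) contribute 0 to both sums. *)
definition abs_continuous_on :: "real \<Rightarrow> real \<Rightarrow> (real \<Rightarrow> 'a::metric_space) \<Rightarrow> bool" where
  "abs_continuous_on a b c \<longleftrightarrow>
     (\<forall>\<epsilon>>0. \<exists>\<delta>>0. \<forall>D. finite D \<longrightarrow>
        (\<forall>(x, y)\<in>D. a \<le> x \<and> x \<le> y \<and> y \<le> b) \<longrightarrow>
        disjoint_family_on (\<lambda>(x, y). {x<..<y}) D \<longrightarrow>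
        (\<Sum>(x, y)\<in>D. y - x) < \<delta> \<longrightarrow>
        (\<Sum>(x, y)\<in>D. dist (c x) (c y)) < \<epsilon>)"

definition path_velocity :: "real \<Rightarrow> real \<Rightarrow> (real \<Rightarrow> 'a::real_normed_vector) \<Rightarrow> real \<Rightarrow> 'a" where
  "path_velocity a b c t = vector_derivative c (at t within {a..b})"

(* "Not an endpoint" compares points of configuration space, not parameter values: a path that
   rests for a while at a collision endpoint has no interior collision point on that account. *)
definition interior_collision_point ::
    "('a \<Rightarrow> ereal) \<Rightarrow> real \<Rightarrow> real \<Rightarrow> (real \<Rightarrow> 'a) \<Rightarrow> 'a \<Rightarrow> bool" where
  "interior_collision_point U a b c p \<longleftrightarrow>
     collision_point U p \<and> p \<in> c ` {a..b} \<and> p \<noteq> c a \<and> p \<noteq> c b"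

(* e2ennreal truncates negative values to 0; it is only applied to U \<ge> 0 *)
definition action :: "('a::real_normed_vector \<Rightarrow> ereal) \<Rightarrow> real \<Rightarrow> (real \<Rightarrow> 'a) \<Rightarrow> ennreal" where
  "action U T c =
     (\<integral>\<^sup>+t\<in>{0..T}. (ennreal ((norm (path_velocity 0 T c t))\<^sup>2 / 2) + e2ennreal (U (c t))) \<partial>lborel)"

definition joins_in_time :: "real \<Rightarrow> 'a::real_normed_vector \<Rightarrow> 'a \<Rightarrow> (real \<Rightarrow> 'a) \<Rightarrow> bool" where
  "joins_in_time T q0 q1 c \<longleftrightarrow> abs_continuous_on 0 T c \<and> c 0 = q0 \<and> c T = q1"

definition action_minimizer ::
    "('a::real_normed_vector \<Rightarrow> ereal) \<Rightarrow> real \<Rightarrow> 'a \<Rightarrow> 'a \<Rightarrow> (real \<Rightarrow> 'a) \<Rightarrow> bool" where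
  "action_minimizer U T q0 q1 c \<longleftrightarrow>
     joins_in_time T q0 q1 c \<and> action U T c < \<infinity> \<and>
     (\<forall>\<sigma>. joins_in_time T q0 q1 \<sigma> \<longrightarrow> action U T c \<le> action U T \<sigma>)"

definition marchal_lemma :: "('a::real_normed_vector \<Rightarrow> ereal) \<Rightarrow> bool" where
  "marchal_lemma V \<longleftrightarrow>
     (let U = (\<lambda>q. - V q) in
      \<forall>q0 q1 T c. 0 < T \<longrightarrow> action_minimizer U T q0 q1 c \<longrightarrow>
        \<not> (\<exists>p. interior_collision_point U 0 T c p))"

definition hill_region :: "('a \<Rightarrow> ereal) \<Rightarrow> real \<Rightarrow> 'a set" where
  "hill_region U h = {q. 0 \<le> ereal h + U q}"

definition sqrt_ereal :: "ereal \<Rightarrow> ennreal" where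
  "sqrt_ereal x = (if x = \<infinity> then \<infinity> else ennreal (sqrt (real_of_ereal x)))"

(* The integrand is a product in ennreal, so \<infinity> * 0 = 0: resting at a collision point costs nothing. *)
definition jm_length ::
    "('a::real_normed_vector \<Rightarrow> ereal) \<Rightarrow> real \<Rightarrow> real \<Rightarrow> real \<Rightarrow> (real \<Rightarrow> 'a) \<Rightarrow> ennreal" where
  "jm_length U h a b c =
     (\<integral>\<^sup>+t\<in>{a..b}. (sqrt_ereal (2 * (ereal h + U (c t))) * ennreal (norm (path_velocity a b c t))) \<partial>lborel)"

definition hill_curve ::
    "('a::real_normed_vector \<Rightarrow> ereal) \<Rightarrow> real \<Rightarrow> real \<Rightarrow> real \<Rightarrow> (real \<Rightarrow> 'a) \<Rightarrow> bool" where
  "hill_curve U h a b c \<longleftrightarrow> a < b \<and> abs_continuous_on a b c \<and> c ` {a..b} \<subseteq> hill_region U h"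

definition minimizing_jm_geodesic ::
    "('a::real_normed_vector \<Rightarrow> ereal) \<Rightarrow> real \<Rightarrow> real \<Rightarrow> real \<Rightarrow> (real \<Rightarrow> 'a) \<Rightarrow> bool" where
  "minimizing_jm_geodesic U h a b c \<longleftrightarrow>
     hill_curve U h a b c \<and> jm_length U h a b c < \<infinity> \<and>
     (\<forall>a' b' \<sigma>. hill_curve U h a' b' \<sigma> \<longrightarrow> \<sigma> a' = c a \<longrightarrow> \<sigma> b' = c b \<longrightarrow>
        jm_length U h a b c \<le> jm_length U h a' b' \<sigma>)"

definition jm_marchal_lemma :: "('a::real_normed_vector \<Rightarrow> ereal) \<Rightarrow> real \<Rightarrow> bool" where
  "jm_marchal_lemma V h \<longleftrightarrow>
     (let U = (\<lambda>q. - V q) in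
      \<forall>a b c. minimizing_jm_geodesic U h a b c \<longrightarrow>
        \<not> (\<exists>p. interior_collision_point U a b c p))"

end

theory Submission
  imports Defs
begin

text \<open>
  By the arithmetic-geometric mean inequality the integrand of the length at energy \<open>0\<close> is
  bounded by the Lagrangian, with equality exactly when \<open>|q'|\<^sup>2 / 2 = U q\<close>. Travel along a
  minimizing geodesic \<open>c\<close> with that speed: new time is \<open>F t = \<integral> |c'| / sqrt (2 U c)\<close>, and
  \<open>q (F t) = c t\<close>. The action of \<open>q\<close> is then the length of \<open>c\<close>, so \<open>q\<close> minimizes the action in
  its own travel time and passes through the same collision point.

  The change of time is done on measures: \<open>F\<close> pushes the density \<open>F'\<close> forward to Lebesgue measure
  on \<open>{0..T}\<close>. It therefore yields \<open>dist (q x) (q y) \<le> \<integral> sqrt (2 U q)\<close> over \<open>{x..y}\<close>, hence absolute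
  continuity of \<open>q\<close> and the bound on its speed, although \<open>F\<close> may be constant on intervals and \<open>F'\<close>
  vanishes at collisions. That absolutely continuous curves are almost everywhere
  differentiable and integrate their derivative is obtained from their variation, the
  Radon-Nikodym theorem and Lebesgue differentiation.
\<close>

subsection \<open>Variation of absolutely continuous curves\<close>

lemma abs_continuous_onI:
  assumes "\<And>\<epsilon>. 0 < \<epsilon> \<Longrightarrow> \<exists>\<delta>>0. \<forall>D. finite D \<longrightarrow> (\<forall>(x, y)\<in>D. a \<le> x \<and> x \<le> y \<and> y \<le> b) \<longrightarrow>
      disjoint_family_on (\<lambda>(x, y). {x<..<y}) D \<longrightarrow> (\<Sum>(x, y)\<in>D. y - x) < \<delta> \<longrightarrow>
      (\<Sum>(x, y)\<in>D. dist (c x) (c y)) < \<epsilon>"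
  shows "abs_continuous_on a b c"
  unfolding abs_continuous_on_def using assms by simp

lemma abs_continuous_onE:
  assumes "abs_continuous_on a b c" "0 < \<epsilon>"
  obtains \<delta> where "0 < \<delta>"
    "\<And>D. finite D \<Longrightarrow> \<forall>(x, y)\<in>D. a \<le> x \<and> x \<le> y \<and> y \<le> b \<Longrightarrow>
        disjoint_family_on (\<lambda>(x, y). {x<..<y}) D \<Longrightarrow> (\<Sum>(x, y)\<in>D. y - x) < \<delta> \<Longrightarrow>
        (\<Sum>(x, y)\<in>D. dist (c x) (c y)) < \<epsilon>"
  using assms(1)[unfolded abs_continuous_on_def, THEN spec, THEN mp, OF assms(2)] by blast

text \<open>Only the open intervals have to lie in \<open>A\<close> and be disjoint, so neighbours
  may share an endpoint. Strictness \<open>x < y\<close> keeps them nonempty: a pair is then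
  determined by its interval, and families over disjoint sets have no pair in common.\<close>

definition interval_family :: "real \<Rightarrow> real \<Rightarrow> real set \<Rightarrow> (real \<times> real) set \<Rightarrow> bool" where
  "interval_family a b A D \<longleftrightarrow> finite D \<and>
     (\<forall>(x, y)\<in>D. a \<le> x \<and> x < y \<and> y \<le> b \<and> {x<..<y} \<subseteq> A) \<and>
     disjoint_family_on (\<lambda>(x, y). {x<..<y}) D"

text \<open>The total variation of \<open>c\<close> over a set that need not be an interval, because
  absolute continuity speaks of finite unions of intervals. As a supremum in \<open>ennreal\<close>
  it exists before finiteness is known.\<close>

definition variation_on :: "real \<Rightarrow> real \<Rightarrow> (real \<Rightarrow> 'a::metric_space) \<Rightarrow> real set \<Rightarrow> ennreal" where
  "variation_on a b c A =
     (SUP D\<in>{D. interval_family a b A D}. ennreal (\<Sum>(x, y)\<in>D. dist (c x) (c y)))"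

lemma interval_family_empty [simp]: "interval_family a b A {}"
  by (simp add: interval_family_def disjoint_family_on_def)

lemma variation_on_upper:
  "interval_family a b A D \<Longrightarrow> ennreal (\<Sum>(x, y)\<in>D. dist (c x) (c y)) \<le> variation_on a b c A"
  unfolding variation_on_def by (rule SUP_upper) simp

lemma variation_on_least:
  assumes "\<And>D. interval_family a b A D \<Longrightarrow> ennreal (\<Sum>(x, y)\<in>D. dist (c x) (c y)) \<le> r"
  shows "variation_on a b c A \<le> r"
  unfolding variation_on_def by (rule SUP_least) (use assms in auto)

lemma variation_on_mono: "A \<subseteq> B \<Longrightarrow> variation_on a b c A \<le> variation_on a b c B"
  by (rule variation_on_least, rule variation_on_upper) (fastforce simp: interval_family_def)

lemma emeasure_disjoint_open_intervals:
  fixes D :: "(real \<times> real) set"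
  assumes "finite D" "\<And>x y. (x, y) \<in> D \<Longrightarrow> x \<le> y"
    "disjoint_family_on (\<lambda>(x, y). {x<..<y}) D"
  shows "emeasure lborel (\<Union>(x, y)\<in>D. {x<..<y}) = ennreal (\<Sum>(x, y)\<in>D. y - x)"
proof -
  have "emeasure lborel (\<Union>p\<in>D. (\<lambda>(x, y). {x<..<y}) p)
      = (\<Sum>p\<in>D. emeasure lborel ((\<lambda>(x, y). {x<..<y}) p))"
    using assms by (intro sum_emeasure[symmetric]) auto
  also have "\<dots> = (\<Sum>p\<in>D. ennreal ((\<lambda>(x, y). y - x) p))"
    using assms(2) by (intro sum.cong) auto
  also have "\<dots> = ennreal (\<Sum>p\<in>D. (\<lambda>(x, y). y - x) p)"
    using assms(2) by (intro sum_ennreal) fastforce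
  finally show ?thesis by simp
qed

text \<open>The intervals of a family inside \<open>A\<close> are disjoint, so their total length is
  at most the measure of \<open>A\<close>, and the \<delta> of absolute continuity serves all such
  families at once.\<close>

lemma variation_on_small:
  assumes "abs_continuous_on a b c" "0 < \<epsilon>"
  obtains \<delta> where "0 < \<delta>"
    "\<And>A. A \<in> sets lborel \<Longrightarrow> emeasure lborel A < ennreal \<delta> \<Longrightarrow> variation_on a b c A \<le> ennreal \<epsilon>"
proof -
  obtain \<delta> where \<delta>: "0 < \<delta>" and
    ac: "\<And>D. finite D \<Longrightarrow> \<forall>(x, y)\<in>D. a \<le> x \<and> x \<le> y \<and> y \<le> b \<Longrightarrow>
        disjoint_family_on (\<lambda>(x, y). {x<..<y}) D \<Longrightarrow> (\<Sum>(x, y)\<in>D. y - x) < \<delta> \<Longrightarrow>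
        (\<Sum>(x, y)\<in>D. dist (c x) (c y)) < \<epsilon>"
    using abs_continuous_onE[OF assms] by blast
  show thesis
  proof (rule that[OF \<delta>], rule variation_on_least)
    fix A :: "real set" and D
    assume A: "A \<in> sets lborel" "emeasure lborel A < ennreal \<delta>" and D: "interval_family a b A D"
    have "ennreal (\<Sum>(x, y)\<in>D. y - x) = emeasure lborel (\<Union>(x, y)\<in>D. {x<..<y})"
      using D by (intro emeasure_disjoint_open_intervals[symmetric]) (auto simp: interval_family_def)
    also have "\<dots> \<le> emeasure lborel A"
      using A D by (intro emeasure_mono) (auto simp: interval_family_def)
    finally have "ennreal (\<Sum>(x, y)\<in>D. y - x) < ennreal \<delta>"
      using A by simp
    then have "(\<Sum>(x, y)\<in>D. y - x) < \<delta>"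
      by (metis ennreal_leI leD leI)
    then have "(\<Sum>(x, y)\<in>D. dist (c x) (c y)) < \<epsilon>"
      using D by (intro ac) (auto simp: interval_family_def)
    then show "ennreal (\<Sum>(x, y)\<in>D. dist (c x) (c y)) \<le> ennreal \<epsilon>"
      by (intro ennreal_leI) simp
  qed
qed

text \<open>A family in \<open>A\<close> and one in \<open>B\<close> combine to a family in
  \<open>A \<union> B\<close>. A common pair would give a nonempty interval inside
  \<open>A \<inter> B\<close>, so there is none and the sums add up.\<close>

lemma variation_on_superadd:
  assumes "A \<inter> B = {}"
  shows "variation_on a b c A + variation_on a b c B \<le> variation_on a b c (A \<union> B)"
proof -
  have *: "ennreal (\<Sum>(x, y)\<in>D. dist (c x) (c y)) + ennreal (\<Sum>(x, y)\<in>E. dist (c x) (c y))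
      \<le> variation_on a b c (A \<union> B)"
    if D: "interval_family a b A D" and E: "interval_family a b B E" for D E
  proof -
    have ne: "{x<..<y} \<noteq> {}" if "(x, y) \<in> D \<union> E" for x y
      using that D E by (auto simp: interval_family_def)
    have disj: "D \<inter> E = {}"
    proof (rule ccontr)
      assume "D \<inter> E \<noteq> {}"
      then obtain x y where xy: "(x, y) \<in> D" "(x, y) \<in> E" by auto
      then have "{x<..<y} \<subseteq> A \<inter> B" using D E by (auto simp: interval_family_def)
      with ne xy assms show False by blast
    qed
    have "disjoint_family_on (\<lambda>(x, y). {x<..<y}) (D \<union> E)"
      unfolding disjoint_family_on_def
    proof (intro ballI impI)
      fix p q assume pq: "p \<in> D \<union> E" "q \<in> D \<union> E" "p \<noteq> q"
      have sub: "(\<lambda>(x, y). {x<..<y}) r \<subseteq> A" if "r \<in> D" for r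
        using D that by (fastforce simp: interval_family_def)
      have sub': "(\<lambda>(x, y). {x<..<y}) r \<subseteq> B" if "r \<in> E" for r
        using E that by (fastforce simp: interval_family_def)
      have dD: "(\<lambda>(x, y). {x<..<y}) p \<inter> (\<lambda>(x, y). {x<..<y}) q = {}" if "p \<in> D" "q \<in> D"
        using D that pq unfolding interval_family_def disjoint_family_on_def by blast
      have dE: "(\<lambda>(x, y). {x<..<y}) p \<inter> (\<lambda>(x, y). {x<..<y}) q = {}" if "p \<in> E" "q \<in> E"
        using E that pq unfolding interval_family_def disjoint_family_on_def by blast
      show "(\<lambda>(x, y). {x<..<y}) p \<inter> (\<lambda>(x, y). {x<..<y}) q = {}"
        using pq dD dE sub[of p] sub[of q] sub'[of p] sub'[of q] assms by blast
    qed
    then have "interval_family a b (A \<union> B) (D \<union> E)"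
      using D E by (auto simp: interval_family_def)
    then have "ennreal (\<Sum>(x, y)\<in>D \<union> E. dist (c x) (c y)) \<le> variation_on a b c (A \<union> B)"
      by (rule variation_on_upper)
    moreover have "(\<Sum>(x, y)\<in>D \<union> E. dist (c x) (c y))
        = (\<Sum>(x, y)\<in>D. dist (c x) (c y)) + (\<Sum>(x, y)\<in>E. dist (c x) (c y))"
      using D E disj by (intro sum.union_disjoint) (auto simp: interval_family_def)
    ultimately show ?thesis
      by (simp add: ennreal_plus sum_nonneg split_beta)
  qed
  have ne: "{D. interval_family a b X D} \<noteq> {}" for X
    using interval_family_empty by blast
  have "variation_on a b c A + ennreal (\<Sum>(x, y)\<in>E. dist (c x) (c y)) \<le> variation_on a b c (A \<union> B)"
    if "interval_family a b B E" for E
    unfolding variation_on_def[of a b c A] ennreal_SUP_add_left[OF ne, symmetric]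
    by (rule SUP_least) (use * that in auto)
  then show ?thesis
    by (subst variation_on_def[of a b c B], subst ennreal_SUP_add_right[OF ne]) (auto intro!: SUP_least)
qed

lemma variation_on_sum_le:
  assumes "finite I" "disjoint_family_on f I"
  shows "(\<Sum>i\<in>I. variation_on a b c (f i)) \<le> variation_on a b c (\<Union>i\<in>I. f i)"
  using assms
proof (induction I rule: finite_induct)
  case (insert i I)
  have "disjoint_family_on f I"
    using insert.prems by (auto simp: disjoint_family_on_def)
  then have "(\<Sum>i\<in>insert i I. variation_on a b c (f i))
      \<le> variation_on a b c (f i) + variation_on a b c (\<Union>i\<in>I. f i)"
    using insert by (simp add: add_left_mono)
  also have "\<dots> \<le> variation_on a b c (f i \<union> (\<Union>i\<in>I. f i))"
    using insert by (intro variation_on_superadd) (auto simp: disjoint_family_on_def)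
  finally show ?case by simp
qed simp

text \<open>Cut every interval of the family at \<open>x\<close>. Only one that straddles
  \<open>x\<close> changes, and the triangle inequality bounds its contribution by those of its two
  halves.\<close>

lemma variation_on_split:
  assumes "a \<le> x" "x \<le> b"
  shows "variation_on a b c {..<y} \<le> variation_on a b c {..<x} + variation_on a b c {x<..<y}"
proof (rule variation_on_least)
  fix D assume D: "interval_family a b {..<y} D"
  \<comment> \<open>A straddling interval belongs to both \<open>L\<close> and \<open>R\<close>;
    \<open>l\<close> keeps the part to the left of \<open>x\<close> and \<open>r\<close> the part to
    the right.\<close>
  define L where "L = {p\<in>D. fst p < x}"
  define R where "R = {p\<in>D. x < snd p}"
  define l where "l = (\<lambda>p::real \<times> real. (fst p, min (snd p) x))"
  define r where "r = (\<lambda>p::real \<times> real. (max (fst p) x, snd p))"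
  have fin: "finite D" "finite L" "finite R"
    using D by (auto simp: interval_family_def L_def R_def)
  have bnd: "a \<le> fst p" "fst p < snd p" "snd p \<le> b" "{fst p<..<snd p} \<subseteq> {..<y}" if "p \<in> D" for p
    using D that by (cases p, fastforce simp: interval_family_def)+
  have dis: "{fst p<..<snd p} \<inter> {fst q<..<snd q} = {}" if "p \<in> D" "q \<in> D" "p \<noteq> q" for p q
    using D that unfolding interval_family_def disjoint_family_on_def by (auto simp: split_beta)
  have disL: "{fst (l p)<..<snd (l p)} \<inter> {fst (l q)<..<snd (l q)} = {}" if "p \<in> L" "q \<in> L" "p \<noteq> q" for p q
    using dis[of p q] that by (auto simp: L_def l_def)
  have disR: "{fst (r p)<..<snd (r p)} \<inter> {fst (r q)<..<snd (r q)} = {}" if "p \<in> R" "q \<in> R" "p \<noteq> q" for p q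
    using dis[of p q] that by (auto simp: R_def r_def)
  have neL: "{fst (l p)<..<snd (l p)} \<noteq> {}" if "p \<in> L" for p
    using bnd[of p] that by (auto simp: L_def l_def)
  have neR: "{fst (r p)<..<snd (r p)} \<noteq> {}" if "p \<in> R" for p
    using bnd[of p] that by (auto simp: R_def r_def)
  \<comment> \<open>Two distinct members with the same truncation would make that interval disjoint
    from itself, hence empty.\<close>
  have injL: "inj_on l L"
    using disL neL by (intro inj_onI) (metis inf.idem)
  have injR: "inj_on r R"
    using disR neR by (intro inj_onI) (metis inf.idem)
  have famL: "interval_family a b {..<x} (l ` L)"
    unfolding interval_family_def
  proof (intro conjI)
    show "disjoint_family_on (\<lambda>(x, y). {x<..<y}) (l ` L)"
      using disL by (auto simp: disjoint_family_on_def split_beta)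
    show "\<forall>(u, v)\<in>l ` L. a \<le> u \<and> u < v \<and> v \<le> b \<and> {u<..<v} \<subseteq> {..<x}"
      using bnd assms by (auto simp: L_def l_def min_le_iff_disj)
  qed (use fin in simp)
  have famR: "interval_family a b {x<..<y} (r ` R)"
    unfolding interval_family_def
  proof (intro conjI)
    show "disjoint_family_on (\<lambda>(x, y). {x<..<y}) (r ` R)"
      using disR by (auto simp: disjoint_family_on_def split_beta)
    show "\<forall>(u, v)\<in>r ` R. a \<le> u \<and> u < v \<and> v \<le> b \<and> {u<..<v} \<subseteq> {x<..<y}"
      using bnd assms by (fastforce simp: R_def r_def le_max_iff_disj)
  qed (use fin in simp)
  let ?d = "\<lambda>p. dist (c (fst p)) (c (snd p))"
  have "(\<Sum>p\<in>D. ?d p) \<le> (\<Sum>p\<in>D. (if p \<in> L then ?d (l p) else 0) + (if p \<in> R then ?d (r p) else 0))"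
  proof (rule sum_mono)
    fix p assume p: "p \<in> D"
    consider "snd p \<le> x" | "x \<le> fst p" | "fst p < x" "x < snd p" by linarith
    then show "?d p \<le> (if p \<in> L then ?d (l p) else 0) + (if p \<in> R then ?d (r p) else 0)"
    proof cases
      case 1 with p bnd[OF p] show ?thesis by (auto simp: L_def R_def l_def r_def min_def)
    next
      case 2 with p bnd[OF p] show ?thesis by (auto simp: L_def R_def l_def r_def max_def)
    next
      case 3 with p bnd[OF p] show ?thesis
        by (auto simp: L_def R_def l_def r_def max_def min_def dist_triangle)
    qed
  qed
  also have "\<dots> = (\<Sum>p\<in>L. ?d (l p)) + (\<Sum>p\<in>R. ?d (r p))"
    unfolding sum.distrib using fin
    by (intro arg_cong2[of _ _ _ _ "(+)"] sum.mono_neutral_cong_right) (auto simp: L_def R_def)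
  also have "\<dots> = (\<Sum>p\<in>l ` L. ?d p) + (\<Sum>p\<in>r ` R. ?d p)"
    using injL injR by (simp add: sum.reindex)
  finally have "ennreal (\<Sum>p\<in>D. ?d p) \<le> ennreal (\<Sum>p\<in>l ` L. ?d p) + ennreal (\<Sum>p\<in>r ` R. ?d p)"
    by (simp add: ennreal_leI sum_nonneg flip: ennreal_plus)
  also have "\<dots> \<le> variation_on a b c {..<x} + variation_on a b c {x<..<y}"
    using variation_on_upper[OF famL, of c] variation_on_upper[OF famR, of c]
    by (intro add_mono) (simp_all add: split_beta)
  finally show "ennreal (\<Sum>(x, y)\<in>D. dist (c x) (c y))
      \<le> variation_on a b c {..<x} + variation_on a b c {x<..<y}"
    by (simp add: split_beta)
qed

text \<open>Take the \<delta> that belongs to the bound 1. Going from \<open>a\<close> to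
  \<open>x\<close> in steps of length \<delta>/2, each step adds at most 1 to the variation; the
  half provides the strict inequality that \<open>variation_on_small\<close> asks for.\<close>

lemma variation_on_finite:
  assumes "abs_continuous_on a b c" "x \<le> b"
  shows "variation_on a b c {..<x} < \<infinity>"
proof -
  obtain \<delta> where \<delta>: "0 < \<delta>" and
    small: "\<And>A. A \<in> sets lborel \<Longrightarrow> emeasure lborel A < ennreal \<delta> \<Longrightarrow> variation_on a b c A \<le> ennreal 1"
    using variation_on_small[OF assms(1), of 1] by auto
  have empty: "variation_on a b c {..<x} = 0" if "x \<le> a" for x
  proof -
    have "D = {}" if D: "interval_family a b {..<x} D" for D
    proof (rule ccontr)
      assume "D \<noteq> {}"
      then obtain u v where "(u, v) \<in> D" by auto
      then have uv: "a \<le> u" "u < v" "{u<..<v} \<subseteq> {..<x}"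
        using D by (auto simp: interval_family_def)
      then have "(u + v) / 2 \<in> {u<..<v}" by auto
      then have "(u + v) / 2 < x" using uv by blast
      then show False using uv \<open>x \<le> a\<close> by auto
    qed
    then show ?thesis
      by (intro antisym variation_on_least) force+
  qed
  have "x \<le> a + real n * (\<delta> / 2) \<Longrightarrow> x \<le> b \<Longrightarrow> variation_on a b c {..<x} \<le> ennreal (real n)" for n x
  proof (induction n arbitrary: x)
    case 0 then show ?case using empty by simp
  next
    case (Suc n)
    show ?case
    proof (cases "x - \<delta> / 2 \<le> a")
      case True
      show ?thesis
      proof (cases "x \<le> a")
        case False
        have "variation_on a b c {..<x} \<le> variation_on a b c {..<a} + variation_on a b c {a<..<x}"
          using Suc.prems False by (intro variation_on_split) auto
        also have "\<dots> \<le> 0 + ennreal 1"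
          using \<delta> True False by (intro add_mono small) (auto simp: empty ennreal_less_iff)
        also have "\<dots> \<le> ennreal (real (Suc n))" by (simp add: ennreal_leI del: ennreal_1)
        finally show ?thesis .
      qed (simp add: empty)
    next
      case False
      let ?x = "x - \<delta> / 2"
      have "variation_on a b c {..<x} \<le> variation_on a b c {..<?x} + variation_on a b c {?x<..<x}"
        using Suc.prems False \<delta> by (intro variation_on_split) auto
      also have "\<dots> \<le> ennreal (real n) + ennreal 1"
        using \<delta> Suc.prems by (intro add_mono small Suc.IH) (auto simp: ennreal_less_iff field_simps)
      also have "\<dots> = ennreal (real (Suc n))" by (simp flip: ennreal_plus ennreal_1 add: add.commute)
      finally show ?thesis .
    qed
  qed
  moreover obtain n where "(x - a) / (\<delta> / 2) \<le> real n" using real_arch_simple by blast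
  then have "x \<le> a + real n * (\<delta> / 2)" using \<delta> by (simp add: field_simps)
  ultimately have "variation_on a b c {..<x} \<le> ennreal (real n)" using assms by blast
  then show ?thesis using ennreal_less_top le_less_trans by (metis infinity_ennreal_def)
qed

text \<open>\<open>V x\<close> is the variation to the left of \<open>x\<close>. Its increment from
  \<open>x\<close> to \<open>y\<close> dominates \<open>dist (c x) (c y)\<close> by superadditivity
  and is at most the variation over \<open>{x<..<y}\<close> by splitting at \<open>x\<close>; the
  second bound carries absolute continuity over from \<open>c\<close> to \<open>V\<close>.\<close>

lemma abs_continuous_majorant:
  assumes "abs_continuous_on a b c"
  obtains V :: "real \<Rightarrow> real" where "abs_continuous_on a b V"
    "\<And>x y. a \<le> x \<Longrightarrow> x \<le> y \<Longrightarrow> y \<le> b \<Longrightarrow> dist (c x) (c y) \<le> V y - V x"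
proof -
  \<comment> \<open>\<open>enn2real\<close> would turn an infinite variation into 0; for
    \<open>x \<le> b\<close>, where \<open>V\<close> is compared with the variation, the value is
    finite.\<close>
  define V where "V x = enn2real (variation_on a b c {..<x})" for x
  have V: "ennreal (V x) = variation_on a b c {..<x}" if "x \<le> b" for x
    using variation_on_finite[OF assms that] by (simp add: V_def ennreal_enn2real_if)
  have V0: "0 \<le> V x" for x by (simp add: V_def)
  have le: "ennreal (V y - V x) \<le> variation_on a b c {x<..<y}" if "a \<le> x" "x \<le> y" "y \<le> b" for x y
  proof -
    have "ennreal (V y) \<le> ennreal (V x) + variation_on a b c {x<..<y}"
      using variation_on_split[of a x b c y] V that by simp
    then show ?thesis
      by (simp add: V0 ennreal_minus ennreal_minus_le_iff flip: ennreal_minus)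
  qed
  have ge: "dist (c x) (c y) \<le> V y - V x" if "a \<le> x" "x \<le> y" "y \<le> b" for x y
  proof (cases "x = y")
    case False
    have "interval_family a b {x<..<y} {(x, y)}"
      using that False by (auto simp: interval_family_def disjoint_family_on_def)
    from variation_on_upper[OF this, of c]
    have "ennreal (dist (c x) (c y)) \<le> variation_on a b c {x<..<y}" by simp
    then have "ennreal (V x) + ennreal (dist (c x) (c y)) \<le> variation_on a b c {..<x} + variation_on a b c {x<..<y}"
      using V that by (intro add_mono) auto
    also have "\<dots> \<le> variation_on a b c ({..<x} \<union> {x<..<y})"
      by (intro variation_on_superadd) auto
    also have "\<dots> \<le> variation_on a b c {..<y}"
      using that by (intro variation_on_mono) auto
    also have "\<dots> = ennreal (V y)" using V that by simp
    finally have "V x + dist (c x) (c y) \<le> V y"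
      by (simp add: V0 flip: ennreal_plus)
    then show ?thesis by simp
  qed simp
  have "abs_continuous_on a b V"
    unfolding abs_continuous_on_def
  proof (intro allI impI)
    fix \<epsilon> :: real assume \<epsilon>: "0 < \<epsilon>"
    \<comment> \<open>A bound on a supremum is not strict, so \<epsilon>/2 leaves room for the
      strict inequality at the end.\<close>
    obtain \<delta> where \<delta>: "0 < \<delta>" and
      small: "\<And>A. A \<in> sets lborel \<Longrightarrow> emeasure lborel A < ennreal \<delta> \<Longrightarrow> variation_on a b c A \<le> ennreal (\<epsilon> / 2)"
      using variation_on_small[OF assms, of "\<epsilon> / 2"] \<epsilon> by auto
    show "\<exists>\<delta>>0. \<forall>D. finite D \<longrightarrow> (\<forall>(x, y)\<in>D. a \<le> x \<and> x \<le> y \<and> y \<le> b) \<longrightarrow>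
        disjoint_family_on (\<lambda>(x, y). {x<..<y}) D \<longrightarrow>
        (\<Sum>(x, y)\<in>D. y - x) < \<delta> \<longrightarrow> (\<Sum>(x, y)\<in>D. dist (V x) (V y)) < \<epsilon>"
    proof (intro exI[of _ \<delta>] conjI allI impI \<delta>)
      fix D assume D: "finite D" "\<forall>(x, y)\<in>D. a \<le> x \<and> x \<le> y \<and> y \<le> b"
        "disjoint_family_on (\<lambda>(x, y). {x<..<y}) D" "(\<Sum>(x, y)\<in>D. y - x) < \<delta>"
      have dV: "dist (V x) (V y) = V y - V x" if "(x, y) \<in> D" for x y
        using ge[of x y] D(2) that order_trans[OF zero_le_dist, of "c x" "c y"]
        by (fastforce simp: dist_real_def)
      have "ennreal (\<Sum>(x, y)\<in>D. dist (V x) (V y)) = (\<Sum>p\<in>D. ennreal (dist (V (fst p)) (V (snd p))))"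
        by (simp add: sum_ennreal split_beta)
      also have "\<dots> \<le> (\<Sum>p\<in>D. variation_on a b c ((\<lambda>(x, y). {x<..<y}) p))"
        using D(2) le dV by (intro sum_mono) fastforce
      also have "\<dots> \<le> variation_on a b c (\<Union>p\<in>D. (\<lambda>(x, y). {x<..<y}) p)"
        using D by (intro variation_on_sum_le)
      also have "\<dots> \<le> ennreal (\<epsilon> / 2)"
      proof (rule small)
        have "emeasure lborel (\<Union>(x, y)\<in>D. {x<..<y}) = ennreal (\<Sum>(x, y)\<in>D. y - x)"
          using D by (intro emeasure_disjoint_open_intervals) auto
        then show "emeasure lborel (\<Union>(x, y)\<in>D. {x<..<y}) < ennreal \<delta>"
          using D \<delta> by (simp add: ennreal_lessI)
        show "(\<Union>(x, y)\<in>D. {x<..<y}) \<in> sets lborel"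
          by (auto intro!: borel_open open_UN)
      qed
      finally have "(\<Sum>(x, y)\<in>D. dist (V x) (V y)) \<le> \<epsilon> / 2"
        using \<epsilon> by (subst (asm) ennreal_le_iff) auto
      then show "(\<Sum>(x, y)\<in>D. dist (V x) (V y)) < \<epsilon>" using \<epsilon> by simp
    qed
  qed
  then show thesis using ge by (rule that)
qed


subsection \<open>Derivatives of absolutely continuous curves\<close>

lemma abs_continuous_on_dominated:
  assumes V: "abs_continuous_on a b V" and "0 < K"
    and le: "\<And>x y. a \<le> x \<Longrightarrow> x \<le> y \<Longrightarrow> y \<le> b \<Longrightarrow> dist (c x) (c y) \<le> K * dist (V x) (V y)"
  shows "abs_continuous_on a b c"
  unfolding abs_continuous_on_def
proof (intro allI impI)
  fix \<epsilon> :: real assume "0 < \<epsilon>"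
  with \<open>0 < K\<close> have "0 < \<epsilon> / K" by simp
  obtain \<delta> where \<delta>: "0 < \<delta>" and
    ac: "\<And>D. finite D \<Longrightarrow> \<forall>(x, y)\<in>D. a \<le> x \<and> x \<le> y \<and> y \<le> b \<Longrightarrow>
        disjoint_family_on (\<lambda>(x, y). {x<..<y}) D \<Longrightarrow> (\<Sum>(x, y)\<in>D. y - x) < \<delta> \<Longrightarrow>
        (\<Sum>(x, y)\<in>D. dist (V x) (V y)) < \<epsilon> / K"
    using abs_continuous_onE[OF V \<open>0 < \<epsilon> / K\<close>] by blast
  show "\<exists>\<delta>>0. \<forall>D. finite D \<longrightarrow> (\<forall>(x, y)\<in>D. a \<le> x \<and> x \<le> y \<and> y \<le> b) \<longrightarrow>
      disjoint_family_on (\<lambda>(x, y). {x<..<y}) D \<longrightarrow>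
      (\<Sum>(x, y)\<in>D. y - x) < \<delta> \<longrightarrow> (\<Sum>(x, y)\<in>D. dist (c x) (c y)) < \<epsilon>"
  proof (intro exI[of _ \<delta>] conjI allI impI \<delta>)
    fix D assume D: "finite D" "\<forall>(x, y)\<in>D. a \<le> x \<and> x \<le> y \<and> y \<le> b"
      "disjoint_family_on (\<lambda>(x, y). {x<..<y}) D" "(\<Sum>(x, y)\<in>D. y - x) < \<delta>"
    have "(\<Sum>(x, y)\<in>D. dist (c x) (c y)) \<le> (\<Sum>(x, y)\<in>D. K * dist (V x) (V y))"
      using D(2) le by (intro sum_mono) auto
    also have "\<dots> = K * (\<Sum>(x, y)\<in>D. dist (V x) (V y))"
      by (simp add: sum_distrib_left split_beta)
    also have "\<dots> < \<epsilon>"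
      using ac[OF D] \<open>0 < K\<close> by (simp add: field_simps)
    finally show "(\<Sum>(x, y)\<in>D. dist (c x) (c y)) < \<epsilon>" .
  qed
qed

lemma abs_continuous_on_imp_continuous_on:
  assumes "abs_continuous_on a b c"
  shows "continuous_on {a..b} c"
  unfolding continuous_on_iff
proof (intro ballI allI impI)
  fix x \<epsilon> :: real assume x: "x \<in> {a..b}" and \<epsilon>: "0 < \<epsilon>"
  obtain \<delta> where \<delta>: "0 < \<delta>" and
    ac: "\<And>D. finite D \<Longrightarrow> \<forall>(x, y)\<in>D. a \<le> x \<and> x \<le> y \<and> y \<le> b \<Longrightarrow>
        disjoint_family_on (\<lambda>(x, y). {x<..<y}) D \<Longrightarrow> (\<Sum>(x, y)\<in>D. y - x) < \<delta> \<Longrightarrow>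
        (\<Sum>(x, y)\<in>D. dist (c x) (c y)) < \<epsilon>"
    using abs_continuous_onE[OF assms \<epsilon>] by blast
  have "dist (c y) (c x) < \<epsilon>" if "y \<in> {a..b}" "dist y x < \<delta>" for y
    using ac[of "{(min x y, max x y)}"] x that
    by (cases "x \<le> y") (auto simp: disjoint_family_on_def dist_real_def dist_commute)
  with \<delta> show "\<exists>\<delta>>0. \<forall>y\<in>{a..b}. dist y x < \<delta> \<longrightarrow> dist (c y) (c x) < \<epsilon>" by blast
qed

text \<open>Enclose \<open>N\<close> in an open set \<open>G\<close> of measure below the \<delta>
  of absolute continuity and cover \<open>N\<close> by countably many non-overlapping closed
  intervals inside \<open>G\<close>. Any finitely many of them have total length below \<delta>, so
  their \<open>M\<close>-measure is at most \<epsilon>; continuity from below extends this to the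
  whole cover.\<close>

lemma mono_abs_continuous_interval_measure_null:
  fixes W :: "real \<Rightarrow> real"
  assumes "a < b" and ac: "abs_continuous_on a b W"
    and mono: "\<And>x y. a \<le> x \<Longrightarrow> x \<le> y \<Longrightarrow> y \<le> b \<Longrightarrow> W x \<le> W y"
    and M_Icc: "\<And>x y. a \<le> x \<Longrightarrow> x \<le> y \<Longrightarrow> y \<le> b \<Longrightarrow> emeasure M {x..y} = ennreal (W y - W x)"
    and sets_M[measurable_cong]: "sets M = sets borel"
    and N: "N \<in> null_sets lborel" "N \<subseteq> {a..b}"
  shows "N \<in> null_sets M"
proof -
  \<comment> \<open>The summand 0 gives the shape that \<open>ennreal_le_epsilon\<close>
    expects.\<close>
  have "emeasure M N \<le> 0 + ennreal \<epsilon>" if \<epsilon>: "0 < \<epsilon>" for \<epsilon> :: real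
  proof -
    obtain \<delta> where \<delta>: "0 < \<delta>" and
    ac: "\<And>D. finite D \<Longrightarrow> \<forall>(x, y)\<in>D. a \<le> x \<and> x \<le> y \<and> y \<le> b \<Longrightarrow>
        disjoint_family_on (\<lambda>(x, y). {x<..<y}) D \<Longrightarrow> (\<Sum>(x, y)\<in>D. y - x) < \<delta> \<Longrightarrow>
        (\<Sum>(x, y)\<in>D. dist (W x) (W y)) < \<epsilon>"
    using abs_continuous_onE[OF ac \<epsilon>] by blast
    obtain G where G: "open G" "N \<subseteq> G" "emeasure lborel (G - N) < \<delta>"
      by (rule outer_regular_lborel[of N \<delta>]) (use N \<delta> in auto)
    have "emeasure lborel G \<le> emeasure lborel (G - N) + emeasure lborel N"
      using G N by (subst emeasure_Diff_null_set) auto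
    then have G_less: "emeasure lborel G < \<delta>"
      using G(3) N(1) by (simp add: null_setsD1)
    \<comment> \<open>The covering lemma puts each interval inside the gauge of one of its points in
      \<open>N\<close>. As \<open>N \<subseteq> G\<close>, that gauge is \<open>G\<close>; the value
      \<open>UNIV\<close> elsewhere only makes \<open>?g\<close> a gauge.\<close>
    let ?g = "\<lambda>x. if x \<in> G then G else UNIV"
    have N_sub: "N \<subseteq> cbox a b" and box_ne: "box a b \<noteq> {}"
      using N \<open>a < b\<close> by auto
    have gauge: "gauge ?g" using G by (auto simp: gauge_def)
    obtain \<D> where \<D>: "countable \<D>"  "\<Union>\<D> \<subseteq> cbox a b"
      "\<And>K. K \<in> \<D> \<Longrightarrow> interior K \<noteq> {} \<and> (\<exists>c d. K = cbox c d)"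
      "pairwise (\<lambda>A B. interior A \<inter> interior B = {}) \<D>"
      "\<And>K. K \<in> \<D> \<Longrightarrow> \<exists>x \<in> N \<inter> K. K \<subseteq> ?g x"
      "N \<subseteq> \<Union>\<D>"
      by (rule covering_lemma[OF N_sub box_ne gauge]) (rule that; assumption)
    have K: "K = {Inf K..Sup K}" "a \<le> Inf K" "Inf K < Sup K" "Sup K \<le> b" "K \<subseteq> G" "interior K = {Inf K<..<Sup K}"
      if K_in: "K \<in> \<D>" for K
    proof -
      obtain c d where cd: "K = cbox c d" "interior K \<noteq> {}" using \<D>(3)[OF K_in] by blast
      then have "c < d" by (auto simp: interior_cbox box_real)
      moreover have "cbox c d \<subseteq> {a..b}" using \<D>(2) K_in cd(1) by (metis Union_upper box_real(2) order_trans)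
      ultimately have "a \<le> c" "d \<le> b" by auto
      with \<open>c < d\<close> cd K_in \<D>(5)[OF K_in] G(2)
      show "K = {Inf K..Sup K}" "a \<le> Inf K" "Inf K < Sup K" "Sup K \<le> b" "K \<subseteq> G" "interior K = {Inf K<..<Sup K}"
        by (auto split: if_splits simp: subset_iff)
    qed
    have sets_K: "K \<in> sets M" if "K \<in> \<D>" for K
      by (subst K(1)[OF that]) (simp add: sets_M)
    have finite_le: "emeasure M (\<Union>F) \<le> \<epsilon>" if F: "finite F" "F \<subseteq> \<D>" for F
    proof -
      let ?e = "\<lambda>K::real set. (Inf K, Sup K)"
      have inj: "inj_on ?e F"
        using K(1) F(2) by (intro inj_onI) (metis prod.inject subsetD)
      have disj: "disjoint_family_on (\<lambda>(x, y). {x<..<y}) (?e ` F)"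
        unfolding disjoint_family_on_def
      proof (intro ballI impI)
        fix p q assume "p \<in> ?e ` F" "q \<in> ?e ` F" "p \<noteq> q"
        then obtain A B where "A \<in> \<D>" "B \<in> \<D>" "p = ?e A" "q = ?e B" "A \<noteq> B" using F by auto
        then show "(\<lambda>(x, y). {x<..<y}) p \<inter> (\<lambda>(x, y). {x<..<y}) q = {}"
          using pairwiseD[OF \<D>(4), of A B] K(6)[of A] K(6)[of B] by simp
      qed
      have "ennreal (\<Sum>(x, y)\<in>?e ` F. y - x) = emeasure lborel (\<Union>(x, y)\<in>?e ` F. {x<..<y})"
        using F K(3) disj by (intro emeasure_disjoint_open_intervals[symmetric]) (auto intro: less_imp_le)
      also have "\<dots> \<le> emeasure lborel G"
      proof (intro emeasure_mono)
        show "(\<Union>(x, y)\<in>?e ` F. {x<..<y}) \<subseteq> G"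
        proof clarsimp
          fix z A assume "A \<in> F" "Inf A < z" "z < Sup A"
          then have "z \<in> interior A" "A \<subseteq> G" using K(5,6)[of A] F by auto
          then show "z \<in> G" using interior_subset by blast
        qed
      qed (use G in auto)
      also have "\<dots> < \<delta>" by (rule G_less)
      finally have "(\<Sum>(x, y)\<in>?e ` F. y - x) < \<delta>"
        by (metis ennreal_leI leD leI)
      then have "(\<Sum>(x, y)\<in>?e ` F. dist (W x) (W y)) < \<epsilon>"
        using F K disj by (intro ac) (auto intro: less_imp_le[OF K(3)])
      then have less: "(\<Sum>K\<in>F. dist (W (Inf K)) (W (Sup K))) < \<epsilon>"
        using inj by (simp add: sum.reindex)
      have "emeasure M (\<Union>F) = emeasure M (\<Union>K\<in>F. K)" by simp
      also have "\<dots> \<le> (\<Sum>K\<in>F. emeasure M K)"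
      proof (rule emeasure_subadditive_finite)
        show "(\<lambda>K. K) ` F \<subseteq> sets M" using sets_K F by auto
      qed (use F in simp)
      also have "\<dots> = (\<Sum>K\<in>F. ennreal (dist (W (Inf K)) (W (Sup K))))"
      proof (rule sum.cong)
        fix A assume "A \<in> F"
        then have A: "A \<in> \<D>" using F by auto
        have "emeasure M A = emeasure M {Inf A..Sup A}" using K(1)[OF A] by simp
        also have "\<dots> = ennreal (W (Sup A) - W (Inf A))"
          using K[OF A] by (intro M_Icc) auto
        also have "\<dots> = ennreal (dist (W (Inf A)) (W (Sup A)))"
          using mono[of "Inf A" "Sup A"] K[OF A] by (auto simp: dist_real_def)
        finally show "emeasure M A = ennreal (dist (W (Inf A)) (W (Sup A)))" .
      qed simp
      also have "\<dots> = ennreal (\<Sum>K\<in>F. dist (W (Inf K)) (W (Sup K)))"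
        by (intro sum_ennreal) auto
      also have "\<dots> \<le> \<epsilon>" using less by (intro ennreal_leI) simp
      finally show ?thesis .
    qed
    show ?thesis
    proof (cases "\<D> = {}")
      case True then show ?thesis using \<D>(6) by simp
    next
      case False
      \<comment> \<open>Finite unions along an enumeration of the cover, which repeats members if
        the cover is finite. The empty cover has no enumeration and was treated apart.\<close>
      define A where "A n = \<Union>(from_nat_into \<D> ` {..<n})" for n
      have A_sets: "range A \<subseteq> sets M"
        unfolding A_def using from_nat_into[OF False] sets_K by (auto intro!: sets.finite_Union)
      have "incseq A" unfolding A_def incseq_def by (auto intro!: Union_mono)
      have "(\<Union>n. A n) = \<Union>\<D>"
      proof -
        have "\<Union>\<D> = \<Union>(range (from_nat_into \<D>))" using False \<D>(1) by (simp add: range_from_nat_into)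
        also have "\<dots> = (\<Union>n. A n)" unfolding A_def by blast
        finally show ?thesis by simp
      qed
      then have "emeasure M N \<le> emeasure M (\<Union>n. A n)"
        using \<D>(6) sets.countable_nat_UN[OF A_sets] by (intro emeasure_mono) auto
      also have "\<dots> = (SUP n. emeasure M (A n))"
        using A_sets \<open>incseq A\<close> by (rule SUP_emeasure_incseq[symmetric])
      also have "\<dots> \<le> \<epsilon>"
        unfolding A_def using from_nat_into[OF False] by (intro SUP_least finite_le) auto
      finally show ?thesis by simp
    qed
  qed
  then have "emeasure M N \<le> 0"
    by (rule ennreal_le_epsilon) auto
  then show ?thesis using N sets_M by (auto simp: null_sets_def)
qed

text \<open>The Stieltjes measure of \<open>W\<close> vanishes on Lebesgue null sets, so the
  Radon-Nikodym theorem gives it a density, and that density integrates to the increments of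
  \<open>W\<close>.\<close>

lemma mono_abs_continuous_density:
  fixes W :: "real \<Rightarrow> real"
  assumes "a < b" and ac: "abs_continuous_on a b W"
    and mono: "\<And>x y. a \<le> x \<Longrightarrow> x \<le> y \<Longrightarrow> y \<le> b \<Longrightarrow> W x \<le> W y"
  obtains h :: "real \<Rightarrow> real" where "integrable lborel h"
    "\<And>x y. a \<le> x \<Longrightarrow> x \<le> y \<Longrightarrow> y \<le> b \<Longrightarrow> (h has_integral (W y - W x)) {x..y}"
proof -
  \<comment> \<open>Extending \<open>W\<close> by constants defines the Stieltjes measure on the
    whole line without adding mass.\<close>
  define X where "X t = W (max a (min b t))" for t
  have X_eq: "X t = W t" if "t \<in> {a..b}" for t using that by (simp add: X_def)
  have X_cont: "continuous_on UNIV X"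
    unfolding X_def using \<open>a < b\<close>
    by (intro continuous_on_compose2[OF abs_continuous_on_imp_continuous_on[OF ac]] continuous_intros) auto
  have X_mono: "X x \<le> X y" if "x \<le> y" for x y
    unfolding X_def using that \<open>a < b\<close> by (intro mono) auto
  define M where "M = interval_measure X"
  have sets_M[measurable_cong]: "sets M = sets borel" by (simp add: M_def)
  have M_Icc: "emeasure M {x..y} = ennreal (X y - X x)" if "x \<le> y" for x y
    unfolding M_def using that X_mono X_cont by (rule emeasure_interval_measure_Icc)
  \<comment> \<open>The complement of \<open>{a..b}\<close> is covered by countably many compact
    intervals on which \<open>X\<close> is constant.\<close>
  have M_outside: "- {a..b} \<in> null_sets M"
  proof -
    have X_right: "continuous (at_right t) X" for t
      using X_cont by (simp add: continuous_on_eq_continuous_at continuous_at_imp_continuous_at_within)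
    have lower: "{a - real (Suc n)..a} \<in> null_sets M" for n
      using M_Icc[of "a - real (Suc n)" a] \<open>a < b\<close> by (auto simp: null_sets_def sets_M X_def)
    have upper: "{b..b + real (Suc n)} \<in> null_sets M" for n
      using M_Icc[of b "b + real (Suc n)"] \<open>a < b\<close> by (auto simp: null_sets_def sets_M X_def)
    have "(\<Union>n. {a - real (Suc n)..a}) \<union> (\<Union>n. {b..b + real (Suc n)}) \<in> null_sets M"
      using lower upper by (intro null_sets.Un null_sets_UN) auto
    moreover have "- {a..b} \<subseteq> (\<Union>n. {a - real (Suc n)..a}) \<union> (\<Union>n. {b..b + real (Suc n)})"
    proof
      fix t assume t: "t \<in> - {a..b}"
      obtain n where n: "\<bar>t - a\<bar> + \<bar>t - b\<bar> \<le> real n" using real_arch_simple by blast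
      show "t \<in> (\<Union>n. {a - real (Suc n)..a}) \<union> (\<Union>n. {b..b + real (Suc n)})"
      proof (cases "t < a")
        case True
        with n have "t \<in> {a - real (Suc n)..a}" by auto
        then show ?thesis by blast
      next
        case False
        with n t have "t \<in> {b..b + real (Suc n)}" by auto
        then show ?thesis by blast
      qed
    qed
    ultimately show ?thesis
      using null_sets_subset[of _ M "- {a..b}"] by (auto simp: sets_M)
  qed
  have "absolutely_continuous lborel M"
    unfolding absolutely_continuous_def
  proof
    fix N :: "real set" assume N: "N \<in> null_sets lborel"
    have "N \<inter> {a..b} \<in> null_sets M"
      using N
      by (intro mono_abs_continuous_interval_measure_null[OF \<open>a < b\<close> ac mono _ sets_M])
        (auto simp: M_Icc X_eq intro: null_set_Int2)
    then have "(N \<inter> {a..b}) \<union> - {a..b} \<in> null_sets M"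
      using M_outside by (rule null_sets.Un)
    then show "N \<in> null_sets M"
      by (rule null_sets_subset) (use N in \<open>auto simp: sets_M\<close>)
  qed
  then obtain h where h[measurable]: "h \<in> borel_measurable lborel" and dens: "density lborel h = M"
    using sigma_finite_measure.Radon_Nikodym[OF lborel.sigma_finite_measure_axioms, of M] by (auto simp: sets_M)
  have h_int: "(\<integral>\<^sup>+t. h t * indicator {x..y} t \<partial>lborel) = ennreal (W y - W x)"
    if "a \<le> x" "x \<le> y" "y \<le> b" for x y
  proof -
    have "(\<integral>\<^sup>+t. h t * indicator {x..y} t \<partial>lborel) = emeasure M {x..y}"
      unfolding dens[symmetric] by (simp add: emeasure_density)
    then show ?thesis using that by (simp add: M_Icc X_eq)
  qed
  have "AE t in lborel. h t * indicator {a..b} t \<noteq> \<infinity>"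
    using h_int[of a b] \<open>a < b\<close> by (intro nn_integral_noteq_infinite) auto
  then have fin: "AE t in lborel. t \<in> {a..b} \<longrightarrow> h t \<noteq> \<infinity>"
    by eventually_elim (auto split: split_indicator_asm)
  \<comment> \<open>On \<open>{a..b}\<close> the density \<open>h\<close> is infinite at most on a
    null set, so replacing \<infinity> by 0 there keeps all integrals. The indicator makes
    \<open>r\<close> integrable on the whole line.\<close>
  define r where "r t = enn2real (h t) * indicator {a..b} t" for t
  have r[measurable]: "r \<in> borel_measurable lborel" unfolding r_def by measurable
  have r_int: "(\<integral>\<^sup>+t. ennreal (if t \<in> {x..y} then r t else 0) \<partial>lborel) = ennreal (W y - W x)"
    if "a \<le> x" "x \<le> y" "y \<le> b" for x y
  proof -
    have "(\<integral>\<^sup>+t. ennreal (if t \<in> {x..y} then r t else 0) \<partial>lborel) = (\<integral>\<^sup>+t. h t * indicator {x..y} t \<partial>lborel)"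
      using fin by (intro nn_integral_cong_AE, eventually_elim)
        (use that in \<open>auto simp: r_def ennreal_enn2real_if split: split_indicator\<close>)
    then show ?thesis using h_int that by simp
  qed
  show thesis
  proof
    have "(\<integral>\<^sup>+t. ennreal (r t) \<partial>lborel) = (\<integral>\<^sup>+t. ennreal (if t \<in> {a..b} then r t else 0) \<partial>lborel)"
      by (intro nn_integral_cong) (auto simp: r_def)
    also have "\<dots> < \<infinity>" using r_int[of a b] \<open>a < b\<close> by simp
    finally show "integrable lborel r"
      by (intro integrableI_nonneg) (auto simp: r_def)
    show "(r has_integral (W y - W x)) {x..y}" if "a \<le> x" "x \<le> y" "y \<le> b" for x y
    proof -
      have "((\<lambda>t. if t \<in> {x..y} then r t else 0) has_integral (W y - W x)) UNIV"
        using that mono r_int by (intro nn_integral_has_integral) (auto simp: r_def)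
      then show ?thesis by (subst (asm) has_integral_restrict_UNIV)
    qed
  qed
qed

text \<open>Lebesgue differentiation gives the right derivative off a null set; applied to the
  reflected function \<open>\<lambda>x. f (- x)\<close> it gives the left one. The null set depends
  on \<open>f\<close> alone and not on \<open>c\<close>, \<open>a\<close> or \<open>b\<close>. At an
  endpoint of \<open>{a..b}\<close> only one side enters.\<close>

lemma has_vector_derivative_ae_of_integral:
  fixes f :: "real \<Rightarrow> 'a::euclidean_space"
  assumes f: "\<And>x y :: real. f integrable_on {x..y}"
  obtains N where "N \<in> null_sets lborel"
    "\<And>c a b t. (\<And>x y :: real. a \<le> x \<Longrightarrow> x \<le> y \<Longrightarrow> y \<le> b \<Longrightarrow> (f has_integral (c y - c x)) {x..y}) \<Longrightarrow>
       t \<in> {a..b} \<Longrightarrow> t \<notin> N \<Longrightarrow> (c has_vector_derivative f t) (at t within {a..b})"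
proof -
  obtain R where R: "negligible R" "\<And>x e. x \<notin> R \<Longrightarrow> 0 < e \<Longrightarrow>
      \<exists>d>0. \<forall>h. 0 < h \<and> h < d \<longrightarrow> norm (integral {x..x + h} f /\<^sub>R h - f x) < e"
    using integrable_ccontinuous_explicit[where f=f] f by auto
  have f': "(\<lambda>x. f (- x)) integrable_on {x..y}" for x y
    using f[of "-y" "-x"] Henstock_Kurzweil_Integration.integrable_reflect_real[of f "-x" "-y"] by simp
  obtain L where L: "negligible L" "\<And>x e. x \<notin> L \<Longrightarrow> 0 < e \<Longrightarrow>
      \<exists>d>0. \<forall>h. 0 < h \<and> h < d \<longrightarrow> norm (integral {x..x + h} (\<lambda>x. f (- x)) /\<^sub>R h - f (- x)) < e"
    using integrable_ccontinuous_explicit[where f="\<lambda>x. f (- x)"] f' by auto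
  \<comment> \<open>The exceptional set of the reflected function is moved back to the original
    variable. It is then enclosed in a Borel null set.\<close>
  have "negligible (uminus ` L)"
    using L(1) by (intro negligible_differentiable_image_negligible) (auto intro!: derivative_intros)
  then have "negligible (R \<union> uminus ` L)" using R by simp
  then obtain N where N: "N \<in> null_sets lborel" "R \<union> uminus ` L \<subseteq> N"
    unfolding negligible_iff_null_sets using null_sets_completion_iff2[of "R \<union> uminus ` L" lborel] by auto
  show thesis
  proof (rule that[OF N(1)])
    fix c a b t
    assume int: "\<And>x y. a \<le> x \<Longrightarrow> x \<le> y \<Longrightarrow> y \<le> b \<Longrightarrow> (f has_integral (c y - c x)) {x..y}"
      and t: "t \<in> {a..b}" "t \<notin> N"
    have "t \<notin> R" "- t \<notin> L" using t N by (auto simp: image_iff dest!: bspec[of _ _ "-t"])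
    show "(c has_vector_derivative f t) (at t within {a..b})"
      unfolding has_vector_derivative_def has_derivative_within_alt
    proof (intro conjI allI impI)
      fix e :: real assume e: "0 < e"
      obtain d1 where d1: "0 < d1" "\<And>h. 0 < h \<Longrightarrow> h < d1 \<Longrightarrow> norm (integral {t..t + h} f /\<^sub>R h - f t) < e"
        using R(2)[OF \<open>t \<notin> R\<close> e] by blast
      obtain d2 where d2: "0 < d2"
        "\<And>h. 0 < h \<Longrightarrow> h < d2 \<Longrightarrow> norm (integral {-t..-t + h} (\<lambda>x. f (- x)) /\<^sub>R h - f (- (- t))) < e"
        using L(2)[OF \<open>- t \<notin> L\<close> e] by blast
      have key: "norm (v - h *\<^sub>R f t) \<le> e * h" if "norm (v /\<^sub>R h - f t) < e" "0 < h" for v h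
      proof -
        have "v - h *\<^sub>R f t = h *\<^sub>R (v /\<^sub>R h - f t)" using that by (simp add: scaleR_diff_right)
        then have "norm (v - h *\<^sub>R f t) = h * norm (v /\<^sub>R h - f t)" using that by simp
        then show ?thesis using that by (simp add: mult.commute)
      qed
      have "norm (c y - c t - (y - t) *\<^sub>R f t) \<le> e * norm (y - t)"
        if y: "y \<in> {a..b}" "norm (y - t) < min d1 d2" for y
      proof (cases y t rule: linorder_cases)
        case equal then show ?thesis by simp
      next
        case greater
        have "integral {t..t + (y - t)} f = c y - c t"
          using int[of t y] t y greater by (simp add: integral_unique)
        with d1(2)[of "y - t"] greater y
        have "norm ((c y - c t) /\<^sub>R (y - t) - f t) < e" by simp
        from key[OF this] greater show ?thesis by simp
      next
        case less
        \<comment> \<open>The increment of \<open>c\<close> to the left of \<open>t\<close> is an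
          integral of the reflected function to the right of \<open>- t\<close>.\<close>
        have "integral {-t..-t + (t - y)} (\<lambda>x. f (- x)) = c t - c y"
          using int[of y t] t y less by (simp add: integral_unique)
        with d2(2)[of "t - y"] less y
        have "norm ((c t - c y) /\<^sub>R (t - y) - f t) < e" by simp
        from key[OF this] less have "norm (c t - c y - (t - y) *\<^sub>R f t) \<le> e * (t - y)" by simp
        also have "c t - c y - (t - y) *\<^sub>R f t = - (c y - c t - (y - t) *\<^sub>R f t)"
          by (simp add: algebra_simps)
        finally show ?thesis using less by (simp only: norm_minus_cancel) simp
      qed
      then show "\<exists>d>0. \<forall>y\<in>{a..b}. norm (y - t) < d \<longrightarrow>
          norm (c y - c t - (y - t) *\<^sub>R f t) \<le> e * norm (y - t)"
        using d1(1) d2(1) by (intro exI[of _ "min d1 d2"]) auto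
    qed (simp add: bounded_linear_scaleR_left)
  qed
qed

text \<open>Adding the majorant \<open>V\<close> to a coordinate of \<open>c\<close> makes it
  monotone, since \<open>V\<close> grows at least as fast as the coordinate can fall. Both
  \<open>V\<close> and the sum then have densities, and their difference is a density for the
  coordinate.\<close>

lemma abs_continuous_derivative:
  fixes c :: "real \<Rightarrow> 'a::euclidean_space"
  assumes "a < b" and ac: "abs_continuous_on a b c"
  obtains f where "integrable lborel f"
    "\<And>x y. a \<le> x \<Longrightarrow> x \<le> y \<Longrightarrow> y \<le> b \<Longrightarrow> (f has_integral (c y - c x)) {x..y}"
    "AE t in lborel. t \<in> {a..b} \<longrightarrow> (c has_vector_derivative f t) (at t within {a..b})"
proof -
  obtain V where V: "abs_continuous_on a b V"
    "\<And>x y. a \<le> x \<Longrightarrow> x \<le> y \<Longrightarrow> y \<le> b \<Longrightarrow> dist (c x) (c y) \<le> V y - V x"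
    using abs_continuous_majorant[OF ac] by blast
  have V_mono: "V x \<le> V y" if "a \<le> x" "x \<le> y" "y \<le> b" for x y
    using V(2)[OF that] zero_le_dist[of "c x" "c y"] by linarith
  obtain h where h: "integrable lborel h"
    "\<And>x y. a \<le> x \<Longrightarrow> x \<le> y \<Longrightarrow> y \<le> b \<Longrightarrow> (h has_integral (V y - V x)) {x..y}"
    using mono_abs_continuous_density[OF \<open>a < b\<close> V(1) V_mono] by blast
  have "\<exists>k. integrable lborel k \<and>
      (\<forall>x y. a \<le> x \<longrightarrow> x \<le> y \<longrightarrow> y \<le> b \<longrightarrow> (k has_integral ((V y + c y \<bullet> i) - (V x + c x \<bullet> i))) {x..y})"
    if i: "i \<in> Basis" for i
  proof -
    have comp: "\<bar>(c y - c x) \<bullet> i\<bar> \<le> V y - V x" if "a \<le> x" "x \<le> y" "y \<le> b" for x y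
      using V(2)[OF that] Basis_le_norm[OF i, of "c y - c x"] by (simp add: dist_norm norm_minus_commute)
    \<comment> \<open>The factor 2 counts the increment of \<open>V\<close> once for
      \<open>V\<close> itself and once as a bound for the coordinate.\<close>
    have ac_i: "abs_continuous_on a b (\<lambda>t. V t + c t \<bullet> i)"
    proof (rule abs_continuous_on_dominated[OF V(1), of 2])
      fix x y assume "a \<le> x" "x \<le> y" "y \<le> b"
      from comp[OF this] show "dist (V x + c x \<bullet> i) (V y + c y \<bullet> i) \<le> 2 * dist (V x) (V y)"
        by (simp add: dist_real_def inner_diff_left)
    qed simp
    have mono_i: "V x + c x \<bullet> i \<le> V y + c y \<bullet> i" if "a \<le> x" "x \<le> y" "y \<le> b" for x y
      using comp[OF that] by (simp add: inner_diff_left)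
    show ?thesis
      by (rule mono_abs_continuous_density[OF \<open>a < b\<close> ac_i mono_i]) auto
  qed
  then obtain k where k: "\<And>i. i \<in> Basis \<Longrightarrow> integrable lborel (k i)"
    "\<And>i x y. i \<in> Basis \<Longrightarrow> a \<le> x \<Longrightarrow> x \<le> y \<Longrightarrow> y \<le> b \<Longrightarrow>
      (k i has_integral ((V y + c y \<bullet> i) - (V x + c x \<bullet> i))) {x..y}"
    by metis
  \<comment> \<open>Subtracting \<open>h\<close>, the density of \<open>V\<close>, undoes the shift
    by \<open>V\<close> in each coordinate.\<close>
  define f where "f t = (\<Sum>i\<in>Basis. (k i t - h t) *\<^sub>R i)" for t
  have f_int: "integrable lborel f"
    unfolding f_def using k(1) h(1) by (intro Bochner_Integration.integrable_sum) auto
  have f_has: "(f has_integral (c y - c x)) {x..y}" if "a \<le> x" "x \<le> y" "y \<le> b" for x y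
  proof -
    have "((\<lambda>t. \<Sum>i\<in>Basis. (k i t - h t) *\<^sub>R i) has_integral
        (\<Sum>i\<in>Basis. ((V y + c y \<bullet> i) - (V x + c x \<bullet> i) - (V y - V x)) *\<^sub>R i)) {x..y}"
      using that by (intro has_integral_sum has_integral_scaleR_left has_integral_diff k(2) h(2)) auto
    also have "(\<Sum>i\<in>Basis. ((V y + c y \<bullet> i) - (V x + c x \<bullet> i) - (V y - V x)) *\<^sub>R i)
        = (\<Sum>i\<in>Basis. ((c y - c x) \<bullet> i) *\<^sub>R i)"
      by (intro sum.cong) (simp_all add: inner_diff_left)
    finally show ?thesis by (simp add: f_def[abs_def] euclidean_representation)
  qed
  have "f integrable_on {x..y}" for x y
    using integrable_on_lborel[OF f_int] integrable_on_subinterval by blast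
  then obtain N where N: "N \<in> null_sets lborel"
    "\<And>c a b t. (\<And>x y :: real. a \<le> x \<Longrightarrow> x \<le> y \<Longrightarrow> y \<le> b \<Longrightarrow> (f has_integral (c y - c x)) {x..y}) \<Longrightarrow>
       t \<in> {a..b} \<Longrightarrow> t \<notin> N \<Longrightarrow> (c has_vector_derivative f t) (at t within {a..b})"
    using has_vector_derivative_ae_of_integral by blast
  have "AE t in lborel. t \<in> {a..b} \<longrightarrow> (c has_vector_derivative f t) (at t within {a..b})"
    using AE_not_in[OF N(1)] by eventually_elim (use N(2)[OF f_has] in auto)
  with f_int f_has show thesis by (rule that)
qed


subsection \<open>Change of time\<close>

text \<open>Truncate \<open>h\<close> at a level \<open>n\<close> so high that the loss in the
  integral is at most \<epsilon>/2. The truncated part contributes at most \<open>n\<close> times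
  the measure of \<open>A\<close>.\<close>

lemma nn_integral_uniformly_small:
  fixes h :: "'a \<Rightarrow> ennreal" and \<epsilon> :: real
  assumes [measurable]: "h \<in> borel_measurable M" and fin: "(\<integral>\<^sup>+t. h t \<partial>M) < \<infinity>" and "0 < \<epsilon>"
  obtains \<delta> :: real where "0 < \<delta>"
    "\<And>A. A \<in> sets M \<Longrightarrow> emeasure M A < ennreal \<delta> \<Longrightarrow> (\<integral>\<^sup>+t\<in>A. h t \<partial>M) \<le> ennreal \<epsilon>"
proof -
  let ?m = "\<lambda>n::nat. \<lambda>t. min (h t) (of_nat n)"
  have SUP_m: "(SUP n. ?m n t) = h t" for t
  proof (cases "h t" rule: ennreal_cases)
    case (real r)
    obtain n where "r \<le> real n" using real_arch_simple by blast
    then have "h t \<le> of_nat n" using real by (simp add: ennreal_of_nat_eq_real_of_nat ennreal_leI)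
    then have "h t \<le> (SUP n. ?m n t)" by (intro SUP_upper2[of n]) auto
    then show ?thesis by (intro antisym SUP_least) auto
  next
    case top
    then show ?thesis by (simp add: ennreal_SUP_of_nat_eq_top)
  qed
  have "(SUP n. \<integral>\<^sup>+t. ?m n t \<partial>M) = (\<integral>\<^sup>+t. (SUP n. ?m n t) \<partial>M)"
    by (intro nn_integral_monotone_convergence_SUP[symmetric])
      (auto simp: incseq_def le_fun_def min_le_iff_disj intro!: min.mono)
  then have SUP_int: "(\<integral>\<^sup>+t. h t \<partial>M) = (SUP n. \<integral>\<^sup>+t. ?m n t \<partial>M)"
    by (simp add: SUP_m)
  obtain n where n: "(\<integral>\<^sup>+t. h t \<partial>M) < (\<integral>\<^sup>+t. ?m n t \<partial>M) + ennreal (\<epsilon> / 2)"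
    using SUP_approx_ennreal[OF _ _ SUP_int, of "\<epsilon> / 2"] fin \<open>0 < \<epsilon>\<close> by (auto simp: less_top)
  have m_le: "(\<integral>\<^sup>+t. ?m n t \<partial>M) \<le> (\<integral>\<^sup>+t. h t \<partial>M)" by (intro nn_integral_mono) simp
  then have m_fin: "(\<integral>\<^sup>+t. ?m n t \<partial>M) < \<infinity>" using fin by (rule le_less_trans)
  have diff: "(\<integral>\<^sup>+t. h t - ?m n t \<partial>M) \<le> ennreal (\<epsilon> / 2)"
  proof -
    have "(\<integral>\<^sup>+t. h t - ?m n t \<partial>M) = (\<integral>\<^sup>+t. h t \<partial>M) - (\<integral>\<^sup>+t. ?m n t \<partial>M)"
      using m_fin by (intro nn_integral_diff) auto
    then show ?thesis using n m_fin by (auto simp: ennreal_minus_le_iff less_imp_le)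
  qed
  \<comment> \<open>The choice makes \<open>n * \<delta>\<close> at most \<epsilon>/2;
    \<open>n + 1\<close> avoids division by zero when \<open>n = 0\<close>.\<close>
  define \<delta> where "\<delta> = \<epsilon> / (2 * (real n + 1))"
  have \<delta>: "0 < \<delta>" using \<open>0 < \<epsilon>\<close> by (simp add: \<delta>_def)
  show thesis
  proof (rule that[OF \<delta>])
    fix A assume A[measurable]: "A \<in> sets M" and less: "emeasure M A < ennreal \<delta>"
    have "(\<integral>\<^sup>+t\<in>A. h t \<partial>M) \<le> (\<integral>\<^sup>+t. of_nat n * indicator A t + (h t - ?m n t) \<partial>M)"
    proof (intro nn_integral_mono)
      fix t
      have "h t = ?m n t + (h t - ?m n t)" by (rule add_diff_inverse_ennreal[symmetric]) simp
      also have "\<dots> \<le> of_nat n + (h t - ?m n t)" by (intro add_right_mono) simp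
      finally show "h t * indicator A t \<le> of_nat n * indicator A t + (h t - ?m n t)"
        by (simp split: split_indicator)
    qed
    also have "\<dots> = of_nat n * emeasure M A + (\<integral>\<^sup>+t. h t - ?m n t \<partial>M)"
      by (subst nn_integral_add) (auto simp: nn_integral_cmult)
    also have "\<dots> \<le> ennreal (real n) * ennreal \<delta> + ennreal (\<epsilon> / 2)"
      using less diff by (intro add_mono mult_mono) (auto simp: ennreal_of_nat_eq_real_of_nat less_imp_le)
    also have "\<dots> = ennreal (real n * \<delta> + \<epsilon> / 2)"
      using \<delta> \<open>0 < \<epsilon>\<close> by (simp add: ennreal_mult ennreal_plus)
    also have "\<dots> \<le> ennreal \<epsilon>"
      using \<open>0 < \<epsilon>\<close> by (intro ennreal_leI) (simp add: \<delta>_def field_simps)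
    finally show "(\<integral>\<^sup>+t\<in>A. h t \<partial>M) \<le> ennreal \<epsilon>" .
  qed
qed

text \<open>The intervals are disjoint, so the sum of the distances is at most the integral of
  \<open>h\<close> over their union, and this is small as soon as the union has small measure. It
  serves both the new time \<open>F\<close> and the reparametrized curve \<open>q\<close>.\<close>

lemma abs_continuous_on_of_nn_integral:
  fixes h :: "real \<Rightarrow> ennreal"
  assumes [measurable]: "h \<in> borel_measurable borel" and fin: "(\<integral>\<^sup>+t\<in>{a..b}. h t \<partial>lborel) < \<infinity>"
    and le: "\<And>x y. a \<le> x \<Longrightarrow> x \<le> y \<Longrightarrow> y \<le> b \<Longrightarrow>
      ennreal (dist (c x) (c y)) \<le> (\<integral>\<^sup>+t\<in>{x..y}. h t \<partial>lborel)"
  shows "abs_continuous_on a b c"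
proof (rule abs_continuous_onI)
  fix \<epsilon> :: real assume "0 < \<epsilon>"
  then obtain \<delta> where \<delta>: "0 < \<delta>" and
    small: "\<And>A. A \<in> sets lborel \<Longrightarrow> emeasure lborel A < ennreal \<delta> \<Longrightarrow>
      (\<integral>\<^sup>+t\<in>A. h t * indicator {a..b} t \<partial>lborel) \<le> ennreal (\<epsilon> / 2)"
    using nn_integral_uniformly_small[of "\<lambda>t. h t * indicator {a..b} t" lborel "\<epsilon> / 2"] fin by auto
  show "\<exists>\<delta>>0. \<forall>D. finite D \<longrightarrow> (\<forall>(x, y)\<in>D. a \<le> x \<and> x \<le> y \<and> y \<le> b) \<longrightarrow>
      disjoint_family_on (\<lambda>(x, y). {x<..<y}) D \<longrightarrow> (\<Sum>(x, y)\<in>D. y - x) < \<delta> \<longrightarrow>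
      (\<Sum>(x, y)\<in>D. dist (c x) (c y)) < \<epsilon>"
  proof (intro exI[of _ \<delta>] conjI allI impI \<delta>)
    fix D assume D: "finite D" "\<forall>(x, y)\<in>D. a \<le> x \<and> x \<le> y \<and> y \<le> b"
      "disjoint_family_on (\<lambda>(x, y). {x<..<y}) D" "(\<Sum>(x, y)\<in>D. y - x) < \<delta>"
    \<comment> \<open>Reading the integral as a measure makes additivity over the disjoint intervals
      available.\<close>
    let ?I = "\<lambda>(x, y). {x<..<y}" and ?M = "density lborel (\<lambda>t. h t * indicator {a..b} t)"
    have I_sets: "?I p \<in> sets borel" for p :: "real \<times> real" by (cases p) auto
    have U_sets: "(\<Union>p\<in>D. ?I p) \<in> sets borel" using D(1) I_sets by (intro sets.finite_UN) auto
    have M: "emeasure ?M A = (\<integral>\<^sup>+t\<in>A. h t * indicator {a..b} t \<partial>lborel)" if "A \<in> sets borel" for A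
      using that by (intro emeasure_density) auto
    have "ennreal (\<Sum>(x, y)\<in>D. dist (c x) (c y)) = (\<Sum>p\<in>D. ennreal (dist (c (fst p)) (c (snd p))))"
      by (simp add: split_beta)
    also have "\<dots> \<le> (\<Sum>p\<in>D. emeasure ?M (?I p))"
    proof (intro sum_mono)
      fix p assume "p \<in> D"
      then obtain x y where p: "p = (x, y)" "a \<le> x" "x \<le> y" "y \<le> b" using D(2) by (cases p) auto
      \<comment> \<open>Only the open intervals are disjoint; the two endpoints form a null
        set.\<close>
      have "(\<integral>\<^sup>+t\<in>{x..y}. h t \<partial>lborel) = (\<integral>\<^sup>+t\<in>{x<..<y}. h t * indicator {a..b} t \<partial>lborel)"
      proof (rule nn_integral_cong_AE)
        show "AE t in lborel. h t * indicator {x..y} t = h t * indicator {a..b} t * indicator {x<..<y} t"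
          using AE_lborel_singleton[of x] AE_lborel_singleton[of y]
          by eventually_elim (use p in \<open>auto split: split_indicator\<close>)
      qed
      then show "ennreal (dist (c (fst p)) (c (snd p))) \<le> emeasure ?M (?I p)"
        using le[of x y] p by (simp add: M)
    qed
    also have "\<dots> = emeasure ?M (\<Union>p\<in>D. ?I p)"
      using D I_sets by (intro sum_emeasure) auto
    also have "\<dots> = (\<integral>\<^sup>+t\<in>(\<Union>p\<in>D. ?I p). h t * indicator {a..b} t \<partial>lborel)"
      using U_sets by (rule M)
    also have "\<dots> \<le> ennreal (\<epsilon> / 2)"
    proof (rule small)
      have "emeasure lborel (\<Union>p\<in>D. ?I p) = ennreal (\<Sum>(x, y)\<in>D. y - x)"
        using D by (intro emeasure_disjoint_open_intervals) auto
      then show "emeasure lborel (\<Union>p\<in>D. ?I p) < ennreal \<delta>"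
        using D \<delta> by (simp add: ennreal_lessI)
    qed (use U_sets in simp)
    finally have "(\<Sum>(x, y)\<in>D. dist (c x) (c y)) \<le> \<epsilon> / 2"
      using \<open>0 < \<epsilon>\<close> by (subst (asm) ennreal_le_iff) auto
    then show "(\<Sum>(x, y)\<in>D. dist (c x) (c y)) < \<epsilon>" using \<open>0 < \<epsilon>\<close> by simp
  qed
qed

lemma dist_le_nn_integral_of_has_integral:
  fixes f :: "real \<Rightarrow> 'a::euclidean_space"
  assumes f: "integrable lborel f" and int: "(f has_integral (u - v)) {x..y}"
  shows "ennreal (dist v u) \<le> (\<integral>\<^sup>+t\<in>{x..y}. ennreal (norm (f t)) \<partial>lborel)"
proof -
  have s: "set_integrable lborel {x..y} f"
    unfolding set_integrable_def by (rule integrable_mult_indicator[OF _ f]) simp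
  have "u - v = (LINT t:{x..y}|lborel. f t)"
    using set_borel_integral_eq_integral(2)[OF s] integral_unique[OF int] by simp
  then have "ennreal (dist v u) = ennreal (norm (LINT t:{x..y}|lborel. f t))"
    by (metis dist_commute dist_norm)
  also have "\<dots> \<le> (\<integral>\<^sup>+t. ennreal (norm (indicator {x..y} t *\<^sub>R f t)) \<partial>lborel)"
    unfolding set_lebesgue_integral_def
    by (rule integral_norm_bound_ennreal) (use s in \<open>simp add: set_integrable_def\<close>)
  also have "\<dots> = (\<integral>\<^sup>+t\<in>{x..y}. ennreal (norm (f t)) \<partial>lborel)"
    by (intro nn_integral_cong) (simp split: split_indicator)
  finally show ?thesis .
qed

text \<open>\<open>F\<close> is the distribution function of the measure with density
  \<open>g\<close>. The last claim says that \<open>F\<close> maps this measure to Lebesgue measure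
  on \<open>{0..T}\<close>. It is verified on half-lines, where neither an inverse nor a derivative
  of \<open>F\<close> enters, so \<open>F\<close> may be constant on intervals.\<close>

lemma time_change:
  fixes g :: "real \<Rightarrow> ennreal"
  assumes "a < b" and g[measurable]: "g \<in> borel_measurable borel"
    and fin: "(\<integral>\<^sup>+t. g t \<partial>lborel) < \<infinity>" and outside: "\<And>t. t \<notin> {a..b} \<Longrightarrow> g t = 0"
  obtains F :: "real \<Rightarrow> real" and T where "0 \<le> T" "mono F" "F a = 0" "F b = T"
    "\<And>\<tau>. \<tau> \<in> {0..T} \<Longrightarrow> \<exists>t\<in>{a..b}. F t = \<tau>"
    "\<And>x y. x \<le> y \<Longrightarrow> (\<integral>\<^sup>+t\<in>{x..y}. g t \<partial>lborel) = ennreal (F y - F x)"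
    "\<And>h. h \<in> borel_measurable borel \<Longrightarrow>
       (\<integral>\<^sup>+t. g t * h (F t) \<partial>lborel) = (\<integral>\<^sup>+\<tau>\<in>{0..T}. h \<tau> \<partial>lborel)"
proof -
  have left: "g t = 0" if "t < a" for t using that outside by simp
  have right: "g t = 0" if "b < t" for t using that outside by simp
  define M where "M = density lborel g"
  have sets_M[measurable_cong]: "sets M = sets borel" by (simp add: M_def)
  have M: "emeasure M A = (\<integral>\<^sup>+t\<in>A. g t \<partial>lborel)" if "A \<in> sets borel" for A
    unfolding M_def using that by (intro emeasure_density) auto
  have "emeasure M (space M) = (\<integral>\<^sup>+t. g t \<partial>lborel)"
    by (simp add: M_def emeasure_density)
  then interpret M: finite_measure M
    using fin by (intro finite_measureI) simp
  define F where "F t = measure M {..t}" for t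
  define T where "T = F b"
  have F: "emeasure M {..t} = ennreal (F t)" for t
    by (simp add: F_def M.emeasure_eq_measure)
  have F0: "0 \<le> F t" for t by (simp add: F_def)
  have F_mono: "F x \<le> F y" if "x \<le> y" for x y
    unfolding F_def using that by (intro M.finite_measure_mono) (auto simp: sets_M)
  have F_a: "F a = 0"
  proof -
    have "emeasure M {..a} = (\<integral>\<^sup>+t. 0 \<partial>(lborel :: real measure))"
      unfolding M[OF atMost_borel]
      using AE_lborel_singleton[of a]
      by (intro nn_integral_cong_AE, eventually_elim) (use left in \<open>auto split: split_indicator\<close>)
    then show ?thesis using F0[of a] by (simp add: F)
  qed
  have F_le: "F t = 0" if "t \<le> a" for t using F_mono[OF that] F0[of t] F_a by simp
  have F_ge: "F t = T" if "b \<le> t" for t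
  proof -
    have "emeasure M {..t} = emeasure M {..b}"
      unfolding M[OF atMost_borel] using right that
      by (intro nn_integral_cong) (auto split: split_indicator)
    then show ?thesis using F0 by (simp add: F T_def)
  qed
  have F_Ioc: "emeasure M {x<..y} = ennreal (F y - F x)" if "x \<le> y" for x y
  proof -
    have "{..y} - {..x} = {x<..y}" by auto
    then have "measure M {x<..y} = F y - F x"
      unfolding F_def using that M.finite_measure_Diff[of "{..y}" "{..x}"] by (auto simp: sets_M)
    then show ?thesis by (simp add: M.emeasure_eq_measure)
  qed
  have F_Icc: "(\<integral>\<^sup>+t\<in>{x..y}. g t \<partial>lborel) = ennreal (F y - F x)" if "x \<le> y" for x y
  proof -
    have "(\<integral>\<^sup>+t\<in>{x..y}. g t \<partial>lborel) = (\<integral>\<^sup>+t\<in>{x<..y}. g t \<partial>lborel)"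
      using AE_lborel_singleton[of x]
      by (intro nn_integral_cong_AE, eventually_elim) (auto split: split_indicator)
    then show ?thesis using F_Ioc[OF that] by (simp add: M)
  qed
  have "abs_continuous_on a b F"
  proof (rule abs_continuous_on_of_nn_integral[OF g])
    have "(\<integral>\<^sup>+t\<in>{a..b}. g t \<partial>lborel) \<le> (\<integral>\<^sup>+t. g t \<partial>lborel)"
      by (intro nn_integral_mono) (simp split: split_indicator)
    then show "(\<integral>\<^sup>+t\<in>{a..b}. g t \<partial>lborel) < \<infinity>" using fin by (rule le_less_trans)
    show "ennreal (dist (F x) (F y)) \<le> (\<integral>\<^sup>+t\<in>{x..y}. g t \<partial>lborel)" if "x \<le> y" for x y
      using F_Icc[OF that] F_mono[OF that] by (simp add: dist_real_def)
  qed
  then have cont: "continuous_on {a..b} F" by (rule abs_continuous_on_imp_continuous_on)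
  have onto: "\<exists>t\<in>{a..b}. F t = \<tau>" if "\<tau> \<in> {0..T}" for \<tau>
    using IVT'[of F a \<tau> b] that cont \<open>a < b\<close> by (auto simp: F_a T_def)
  have F_meas[measurable]: "F \<in> borel_measurable borel"
    by (rule borel_measurable_mono) (auto simp: mono_def F_mono)
  have T0: "0 \<le> T" using F0 by (simp add: T_def)
  \<comment> \<open>Two measures that are finite and equal on all half-lines \<open>{x<..}\<close>
    coincide.\<close>
  have distr: "distr M borel F = density lborel (indicator {0..T})"
  proof (rule measure_eqI_lessThan)
    fix x :: real
    have M_Ioi: "emeasure M {s<..} = ennreal (T - F s)" for s
    proof -
      have "emeasure M {s<..} = emeasure M {s<..max s b}"
        unfolding M[OF greaterThan_borel] M[OF greaterThanAtMost_borel] using right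
        by (intro nn_integral_cong) (auto simp: not_le max_def split: split_indicator if_splits)
      also have "\<dots> = ennreal (F (max s b) - F s)" by (rule F_Ioc) simp
      finally show ?thesis by (simp add: F_ge)
    qed
    \<comment> \<open>\<open>max x 0\<close> covers negative \<open>x\<close>; for
      \<open>x > T\<close> the difference is negative and \<open>ennreal\<close> makes it 0.\<close>
    have dens: "emeasure (density lborel (indicator {0..T})) {x<..} = ennreal (T - max x 0)"
    proof -
      have "emeasure (density lborel (indicator {0..T})) {x<..}
          = (\<integral>\<^sup>+t. indicator {0..T} t * indicator {x<..} t \<partial>lborel)"
        by (rule emeasure_density) auto
      also have "\<dots> = (\<integral>\<^sup>+t. indicator ({0..T} \<inter> {x<..}) t \<partial>lborel)"
        by (simp only: indicator_inter_arith)
      also have "\<dots> = emeasure lborel ({0..T} \<inter> {x<..})"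
        by (rule nn_integral_indicator) simp
      also have "\<dots> = ennreal (T - max x 0)"
      proof (cases "x < 0")
        case True
        then have "{0..T} \<inter> {x<..} = {0..T}" by auto
        then show ?thesis using T0 True by simp
      next
        case False
        then have "{0..T} \<inter> {x<..} = {x<..T}" by auto
        then show ?thesis using False by (cases "x \<le> T") (auto simp: ennreal_neg)
      qed
      finally show ?thesis .
    qed
    have "emeasure (distr M borel F) {x<..} = emeasure M (F -` {x<..})"
      by (simp add: emeasure_distr sets_eq_imp_space_eq[OF sets_M])
    also have "\<dots> = ennreal (T - max x 0)"
    proof -
      consider "x < 0" | "0 \<le> x" "x < T" | "T \<le> x" by linarith
      then show ?thesis
      proof cases
        case 1
        then have "F -` {x<..} = UNIV" using F0 by (auto intro: less_le_trans)
        moreover have "emeasure M UNIV = emeasure M {a - 1<..}"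
          unfolding M[OF greaterThan_borel] M[OF space_in_borel] using left
          by (intro nn_integral_cong) (auto split: split_indicator)
        ultimately show ?thesis using 1 M_Ioi[of "a - 1"] by (simp add: F_le)
      next
        case 2
        \<comment> \<open>The last point \<open>s\<close> with \<open>F s \<le> x\<close> exists by
          compactness. Since the value \<open>x\<close> is attained, \<open>F s = x\<close>, and the
          preimage of \<open>{x<..}\<close> is the half-line beyond \<open>s\<close>, even if
          \<open>F\<close> is constant just before \<open>s\<close>.\<close>
        let ?S = "{t\<in>{a..b}. F t \<le> x}"
        have "closed ({a..b} \<inter> F -` {..x})"
          using cont by (intro continuous_closed_preimage) auto
        then have "compact ({a..b} \<inter> ({a..b} \<inter> F -` {..x}))"
          by (rule compact_Int_closed[OF compact_Icc])
        moreover have "{a..b} \<inter> ({a..b} \<inter> F -` {..x}) = ?S" by auto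
        ultimately have "compact ?S" by simp
        moreover have "?S \<noteq> {}" using \<open>a < b\<close> 2 F_a by (auto intro!: exI[of _ a])
        ultimately obtain s where s: "s \<in> ?S" "\<And>t. t \<in> ?S \<Longrightarrow> t \<le> s"
          using compact_attains_sup[of ?S] by blast
        obtain t where "t \<in> {a..b}" "F t = x" using onto[of x] 2 by auto
        then have "x \<le> F s" using s(2)[of t] F_mono[of t s] by auto
        then have F_s: "F s = x" using s(1) by auto
        have "F -` {x<..} = {s<..}"
        proof (intro set_eqI iffI)
          fix t assume "t \<in> F -` {x<..}"
          then have "\<not> F t \<le> F s" using F_s by simp
          then have "\<not> t \<le> s" using F_mono by blast
          then show "t \<in> {s<..}" by simp
        next
          fix t assume t: "t \<in> {s<..}"
          show "t \<in> F -` {x<..}"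
          proof (cases "t \<le> b")
            case True
            then show ?thesis using s(1) s(2)[of t] t by fastforce
          next
            case False
            then show ?thesis using F_ge[of t] 2 by simp
          qed
        qed
        then show ?thesis using M_Ioi[of s] F_s 2 by simp
      next
        case 3
        have "F t \<le> T" for t using F_mono[of t b] F_ge[of t] by (cases "t \<le> b") (auto simp: T_def)
        then have "\<not> x < F t" for t using 3 by (meson le_less_trans not_less order_trans)
        then have "F -` {x<..} = {}" by auto
        then show ?thesis using 3 T0 by (simp add: ennreal_neg)
      qed
    qed
    finally have eq: "emeasure (distr M borel F) {x<..} = ennreal (T - max x 0)" .
    then show "emeasure (distr M borel F) {x<..} < \<infinity>" by simp
    show "emeasure (distr M borel F) {x<..} = emeasure (density lborel (indicator {0..T})) {x<..}"
      using eq dens by simp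
  qed simp_all
  show thesis
  proof (rule that[OF T0 _ F_a _ onto F_Icc])
    show "mono F" by (simp add: mono_def F_mono)
    show "F b = T" by (simp add: T_def)
    fix h :: "real \<Rightarrow> ennreal" assume h[measurable]: "h \<in> borel_measurable borel"
    have "(\<integral>\<^sup>+t. g t * h (F t) \<partial>lborel) = (\<integral>\<^sup>+t. h (F t) \<partial>M)"
      unfolding M_def by (rule nn_integral_density[symmetric]) auto
    also have "\<dots> = (\<integral>\<^sup>+\<tau>. h \<tau> \<partial>distr M borel F)"
      by (rule nn_integral_distr[symmetric]) auto
    also have "\<dots> = (\<integral>\<^sup>+\<tau>. indicator {0..T} \<tau> * h \<tau> \<partial>lborel)"
      unfolding distr by (rule nn_integral_density) auto
    finally show "(\<integral>\<^sup>+t. g t * h (F t) \<partial>lborel) = (\<integral>\<^sup>+\<tau>\<in>{0..T}. h \<tau> \<partial>lborel)"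
      by (simp add: mult.commute)
  qed
qed


subsection \<open>Reparametrization with prescribed speed\<close>

lemma inverse_antimono_ennreal: "x \<le> y \<Longrightarrow> inverse y \<le> inverse (x :: ennreal)"
proof (cases "x = 0 \<or> y = top")
  case False
  assume "x \<le> y"
  from False obtain s where s: "y = ennreal s" "0 \<le> s" by (cases y rule: ennreal_cases) auto
  with \<open>x \<le> y\<close> obtain r where r: "x = ennreal r" "0 \<le> r"
    by (cases x rule: ennreal_cases) (auto simp: top_unique)
  with False have "0 < r" by auto
  moreover have "r \<le> s" using \<open>x \<le> y\<close> r s by (simp add: ennreal_le_iff)
  ultimately show ?thesis using r s by (simp add: inverse_ennreal ennreal_leI le_imp_inverse_le)
qed auto

text \<open>By continuity \<kappa> stays below any \<open>z > \<kappa> \<tau>\<close> near \<tau>,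
  so difference quotients to the right of \<tau> are at most \<open>z\<close>. The condition
  \<open>\<tau> < T\<close> leaves room on that side.\<close>

lemma norm_has_vector_derivative_le_of_integral_bound:
  fixes q :: "real \<Rightarrow> 'a::real_normed_vector" and \<kappa> :: "real \<Rightarrow> ennreal"
  assumes "0 \<le> \<tau>" "\<tau> < T"
    and deriv: "(q has_vector_derivative v) (at \<tau> within {0..T})"
    and cont: "continuous_on {0..T} \<kappa>"
    and le: "\<And>x y. 0 \<le> x \<Longrightarrow> x \<le> y \<Longrightarrow> y \<le> T \<Longrightarrow>
      ennreal (dist (q x) (q y)) \<le> (\<integral>\<^sup>+t\<in>{x..y}. \<kappa> t \<partial>lborel)"
  shows "ennreal (norm v) \<le> \<kappa> \<tau>"
\<comment> \<open>It suffices to reach every \<open>z\<close> above \<open>\<kappa> \<tau>\<close>.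
  If \<open>\<kappa> \<tau> = \<infinity>\<close> there is no such \<open>z\<close>.\<close>
proof (rule dense_ge)
  fix z assume z: "\<kappa> \<tau> < z"
  show "ennreal (norm v) \<le> z"
  proof (cases z rule: ennreal_cases)
    case (real r)
    have "eventually (\<lambda>x. \<kappa> x < z) (at \<tau> within {0..T})"
      using cont z assms(1,2) by (intro order_tendstoD(2)[of \<kappa> "\<kappa> \<tau>"]) (auto simp: continuous_on_def)
    then obtain d where d: "0 < d" "\<And>x. x \<in> {0..T} \<Longrightarrow> x \<noteq> \<tau> \<Longrightarrow> dist x \<tau> < d \<Longrightarrow> \<kappa> x < z"
      unfolding eventually_at by blast
    have "norm v \<le> r + e" if "0 < e" for e
    proof -
      obtain d' where d': "0 < d'"
        "\<And>y. y \<in> {0..T} \<Longrightarrow> norm (y - \<tau>) < d' \<Longrightarrow> norm (q y - q \<tau> - (y - \<tau>) *\<^sub>R v) \<le> e * norm (y - \<tau>)"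
        using deriv \<open>0 < e\<close> unfolding has_vector_derivative_def has_derivative_within_alt by blast
      \<comment> \<open>A point to the right of \<tau>, strictly within both radii thanks to the
        halves, and not beyond \<open>T\<close>.\<close>
      define y where "y = \<tau> + min (min (d / 2) (d' / 2)) (T - \<tau>)"
      have y: "\<tau> < y" "y \<le> T" "y - \<tau> < d" "y - \<tau> < d'"
        using d(1) d'(1) assms(2) by (auto simp: y_def min_def)
      have "ennreal (dist (q \<tau>) (q y)) \<le> (\<integral>\<^sup>+t\<in>{\<tau>..y}. \<kappa> t \<partial>lborel)"
        using y assms(1) by (intro le) auto
      also have "\<dots> \<le> (\<integral>\<^sup>+t. z * indicator {\<tau>..y} t \<partial>lborel)"
      proof (intro nn_integral_mono)
        fix t
        show "\<kappa> t * indicator {\<tau>..y} t \<le> z * indicator {\<tau>..y} t"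
          using d(2)[of t] z y assms(1) by (cases "t = \<tau>") (auto simp: dist_real_def less_imp_le split: split_indicator)
      qed
      also have "\<dots> = ennreal (r * (y - \<tau>))"
        using y real by (subst nn_integral_cmult) (auto simp: ennreal_mult)
      finally have "norm (q y - q \<tau>) \<le> r * (y - \<tau>)"
        using y real by (simp add: ennreal_le_iff dist_norm norm_minus_commute)
      moreover have "norm (q y - q \<tau> - (y - \<tau>) *\<^sub>R v) \<le> e * (y - \<tau>)"
        using d'(2)[of y] y assms(1) by simp
      moreover have "norm ((y - \<tau>) *\<^sub>R v) \<le> norm (q y - q \<tau>) + norm (q y - q \<tau> - (y - \<tau>) *\<^sub>R v)"
        by (metis add_diff_cancel_left' diff_add_cancel norm_triangle_ineq4 norm_triangle_sub norm_minus_commute add.commute)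
      moreover have "norm ((y - \<tau>) *\<^sub>R v) = (y - \<tau>) * norm v" using y by simp
      moreover have "(y - \<tau>) * (r + e) = r * (y - \<tau>) + e * (y - \<tau>)" by (simp add: algebra_simps)
      ultimately have "(y - \<tau>) * norm v \<le> (y - \<tau>) * (r + e)" by linarith
      then show ?thesis using y by simp
    qed
    then have "norm v \<le> r" by (rule field_le_epsilon)
    then show ?thesis using real by (simp add: ennreal_leI)
  qed simp
qed

text \<open>Here \<open>k\<close> is the prescribed speed as a function of position, infinite values
  allowed. The new time has density \<open>g = |c'| / k(c)\<close>, so the change of time turns
  \<integral> \<open>k(q) * k(q)\<close> into \<integral> \<open>g * k(c) * k(c)\<close>, which is
  the weighted length. The point \<open>t0\<close> excludes a constant curve, whose travel time
  would be 0.\<close>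

lemma reparametrization_by_speed:
  fixes c :: "real \<Rightarrow> 'a::euclidean_space" and k :: "'a \<Rightarrow> ennreal"
  assumes "a < b" and ac: "abs_continuous_on a b c"
    and k_cont: "continuous_on UNIV k" and k_pos: "\<And>x. 0 < k x"
    and length: "(\<integral>\<^sup>+t\<in>{a..b}. k (c t) * ennreal (norm (path_velocity a b c t)) \<partial>lborel) < \<infinity>"
    and "t0 \<in> {a..b}" "c t0 \<noteq> c a"
  obtains q T where "0 < T" "abs_continuous_on 0 T q" "q 0 = c a" "q T = c b" "c ` {a..b} \<subseteq> q ` {0..T}"
    "AE \<tau> in lborel. \<tau> \<in> {0..T} \<longrightarrow> k (q \<tau>) < \<infinity> \<and> ennreal (norm (path_velocity 0 T q \<tau>)) \<le> k (q \<tau>)"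
    "(\<integral>\<^sup>+\<tau>\<in>{0..T}. k (q \<tau>) * k (q \<tau>) \<partial>lborel)
      \<le> (\<integral>\<^sup>+t\<in>{a..b}. k (c t) * ennreal (norm (path_velocity a b c t)) \<partial>lborel)"
proof -
  obtain f where f: "integrable lborel f"
    "\<And>x y. a \<le> x \<Longrightarrow> x \<le> y \<Longrightarrow> y \<le> b \<Longrightarrow> (f has_integral (c y - c x)) {x..y}"
    "AE t in lborel. t \<in> {a..b} \<longrightarrow> (c has_vector_derivative f t) (at t within {a..b})"
    using abs_continuous_derivative[OF \<open>a < b\<close> ac] by blast
  have f_meas[measurable]: "f \<in> borel_measurable borel"
    using borel_measurable_integrable[OF f(1)] by simp
  \<comment> \<open>The speed of \<open>c\<close> is taken from the density \<open>f\<close>, which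
    is measurable and equals the velocity almost everywhere.\<close>
  define w where "w t = ennreal (norm (f t)) * indicator {a..b} t" for t
  define cc where "cc t = c (max a (min b t))" for t
  define K where "K t = k (cc t)" for t
  have cc: "cc t = c t" if "t \<in> {a..b}" for t using that by (simp add: cc_def)
  have cc_cont: "continuous_on UNIV cc"
    unfolding cc_def using \<open>a < b\<close>
    by (intro continuous_on_compose2[OF abs_continuous_on_imp_continuous_on[OF ac]] continuous_intros) auto
  have K_cont: "continuous_on UNIV K"
    unfolding K_def by (rule continuous_on_compose2[OF k_cont cc_cont]) simp
  have w_meas[measurable]: "w \<in> borel_measurable borel" unfolding w_def by measurable
  have K_meas[measurable]: "K \<in> borel_measurable borel"
    using K_cont by (rule borel_measurable_continuous_onI)
  have length_eq: "(\<integral>\<^sup>+t\<in>{a..b}. k (c t) * ennreal (norm (path_velocity a b c t)) \<partial>lborel)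
      = (\<integral>\<^sup>+t. K t * w t \<partial>lborel)"
  proof (rule nn_integral_cong_AE)
    show "AE t in lborel. k (c t) * ennreal (norm (path_velocity a b c t)) * indicator {a..b} t = K t * w t"
      using f(3)
    proof eventually_elim
      case (elim t)
      show ?case
      proof (cases "t \<in> {a..b}")
        case True
        then have "path_velocity a b c t = f t"
          unfolding path_velocity_def using elim \<open>a < b\<close> vector_derivative_within_closed_interval by blast
        then show ?thesis using True by (simp add: w_def K_def cc)
      qed (simp add: w_def)
    qed
  qed
  have Kw_fin: "(\<integral>\<^sup>+t. K t * w t \<partial>lborel) < \<infinity>" using length length_eq by simp
  have w_fin: "(\<integral>\<^sup>+t. w t \<partial>lborel) < \<infinity>"
  proof -
    have "(\<integral>\<^sup>+t. w t \<partial>lborel) \<le> (\<integral>\<^sup>+t. ennreal (norm (f t)) \<partial>lborel)"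
      by (intro nn_integral_mono) (simp add: w_def split: split_indicator)
    also have "\<dots> < \<infinity>" using f(1) by (simp add: integrable_iff_bounded)
    finally show ?thesis .
  qed
  \<comment> \<open>The minimum of \<open>K\<close> over the compact interval is positive, so
    \<open>inverse (K t)\<close> is bounded there and the total travel time is finite.\<close>
  obtain s0 where s0: "s0 \<in> {a..b}" "\<And>t. t \<in> {a..b} \<Longrightarrow> K s0 \<le> K t"
    using continuous_attains_inf[of "{a..b}" K] \<open>a < b\<close> continuous_on_subset[OF K_cont] by auto
  have K_pos: "0 < K t" for t by (simp add: K_def k_pos)
  \<comment> \<open>In \<open>ennreal\<close> the inverse of \<infinity> is 0, so \<open>g\<close>
    vanishes where the prescribed speed is infinite.\<close>
  define g where "g t = w t * inverse (K t)" for t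
  have g_meas[measurable]: "g \<in> borel_measurable borel" unfolding g_def by measurable
  have g_outside: "g t = 0" if "t \<notin> {a..b}" for t using that by (simp add: g_def w_def)
  have g_fin: "(\<integral>\<^sup>+t. g t \<partial>lborel) < \<infinity>"
  proof -
    have "(\<integral>\<^sup>+t. g t \<partial>lborel) \<le> (\<integral>\<^sup>+t. w t * inverse (K s0) \<partial>lborel)"
    proof (intro nn_integral_mono)
      fix t
      show "g t \<le> w t * inverse (K s0)"
      proof (cases "t \<in> {a..b}")
        case True
        then show ?thesis unfolding g_def using s0(2)
          by (intro mult_left_mono inverse_antimono_ennreal) auto
      qed (simp add: g_outside)
    qed
    also have "\<dots> = (\<integral>\<^sup>+t. w t \<partial>lborel) * inverse (K s0)"
      by (rule nn_integral_multc) simp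
    also have "\<dots> < \<infinity>"
    proof -
      have "inverse (K s0) \<noteq> top" using K_pos[of s0] by simp
      then have "inverse (K s0) < top" by (simp only: top.not_eq_extremum)
      then show ?thesis
        using w_fin unfolding infinity_ennreal_def ennreal_mult_less_top by blast
    qed
    finally show ?thesis .
  qed
  \<comment> \<open>Cancelling \<open>K\<close> can fail only where
    \<open>K t = \<infinity>\<close>. There finiteness of the weighted length forces
    \<open>w t = 0\<close> for almost every such \<open>t\<close>, and both sides vanish.\<close>
  have Kg: "AE t in lborel. K t * g t = w t"
  proof -
    have "AE t in lborel. K t * w t \<noteq> \<infinity>"
      using Kw_fin by (intro nn_integral_noteq_infinite) auto
    then show ?thesis
    proof eventually_elim
      case (elim t)
      show ?case
      proof (cases "K t = top")
        case True
        with elim have "w t = 0" by (auto simp: ennreal_top_mult split: if_splits)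
        then show ?thesis by (simp add: g_def)
      next
        case False
        then have "K t * inverse (K t) = 1"
          using K_pos[of t] ennreal_divide_self[of "K t"] by (simp add: divide_ennreal_def less_top)
        then show ?thesis by (simp add: g_def mult.assoc mult.left_commute[of "K t"])
      qed
    qed
  qed
  obtain F :: "real \<Rightarrow> real" and T where T0: "0 \<le> T" and F: "mono F" "F a = 0" "F b = T"
    "\<And>\<tau>. \<tau> \<in> {0..T} \<Longrightarrow> \<exists>t\<in>{a..b}. F t = \<tau>"
    "\<And>x y. x \<le> y \<Longrightarrow> (\<integral>\<^sup>+t\<in>{x..y}. g t \<partial>lborel) = ennreal (F y - F x)"
    "\<And>h. h \<in> borel_measurable borel \<Longrightarrow>
       (\<integral>\<^sup>+t. g t * h (F t) \<partial>lborel) = (\<integral>\<^sup>+\<tau>\<in>{0..T}. h \<tau> \<partial>lborel)"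
    by (rule time_change[OF \<open>a < b\<close> g_meas g_fin g_outside]) (assumption, (rule that; assumption))
  have F_in: "F t \<in> {0..T}" if "t \<in> {a..b}" for t
    using monoD[OF F(1), of a t] monoD[OF F(1), of t b] that F(2,3) by simp
  have dist_le: "ennreal (dist (c x) (c y)) \<le> (\<integral>\<^sup>+t\<in>{x..y}. g t * K t \<partial>lborel)"
    if "a \<le> x" "x \<le> y" "y \<le> b" for x y
  proof -
    have "ennreal (dist (c x) (c y)) \<le> (\<integral>\<^sup>+t\<in>{x..y}. ennreal (norm (f t)) \<partial>lborel)"
      using f(1) f(2)[OF that] by (rule dist_le_nn_integral_of_has_integral)
    also have "\<dots> = (\<integral>\<^sup>+t\<in>{x..y}. g t * K t \<partial>lborel)"
      using Kg by (intro nn_integral_cong_AE, eventually_elim)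
        (use that in \<open>auto simp: w_def mult.commute split: split_indicator\<close>)
    finally show ?thesis .
  qed
  \<comment> \<open>This makes \<open>q\<close> independent of the chosen preimage: where
    \<open>F\<close> does not grow, \<open>g\<close> is zero almost everywhere, and so is
    \<open>g t * K t\<close>, even at infinite speed.\<close>
  have F_eq: "c x = c y" if xy: "x \<in> {a..b}" "y \<in> {a..b}" "F x = F y" for x y
  proof -
    have eq: "c x = c y" if "a \<le> x" "x \<le> y" "y \<le> b" "F x = F y" for x y
    proof -
      have "(\<integral>\<^sup>+t\<in>{x..y}. g t \<partial>lborel) = 0" using F(5)[of x y] that by simp
      then have "AE t in lborel. g t * indicator {x..y} t = 0"
        by (subst (asm) nn_integral_0_iff_AE) auto
      then have "(\<integral>\<^sup>+t\<in>{x..y}. g t * K t \<partial>lborel) = (\<integral>\<^sup>+t. 0 \<partial>(lborel :: real measure))"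
        by (intro nn_integral_cong_AE, eventually_elim) (auto split: split_indicator)
      then show ?thesis using dist_le[of x y] that by simp
    qed
    show ?thesis
    proof (cases "x \<le> y")
      case True then show ?thesis using xy by (intro eq) auto
    next
      case False then show ?thesis using xy by (intro eq[symmetric]) auto
    qed
  qed
  \<comment> \<open>A right inverse of \<open>F\<close> on \<open>{0..T}\<close>. Clamping the
    argument makes it total, and equal clamped values select the same point, so \<phi> is monotone
    and therefore measurable.\<close>
  define \<phi> where "\<phi> \<tau> = (SOME t. t \<in> {a..b} \<and> F t = max 0 (min T \<tau>))" for \<tau>
  have \<phi>: "\<phi> \<tau> \<in> {a..b} \<and> F (\<phi> \<tau>) = max 0 (min T \<tau>)" for \<tau>
  proof -
    have "max 0 (min T \<tau>) \<in> {0..T}" using T0 by auto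
    then have "\<exists>t. t \<in> {a..b} \<and> F t = max 0 (min T \<tau>)" using F(4) by blast
    then show ?thesis unfolding \<phi>_def by (rule someI_ex)
  qed
  have "mono \<phi>"
  proof (rule monoI)
    fix x y :: real assume "x \<le> y"
    then have le: "max 0 (min T x) \<le> max 0 (min T y)" by auto
    show "\<phi> x \<le> \<phi> y"
    proof (cases "max 0 (min T x) = max 0 (min T y)")
      case True then show ?thesis by (simp add: \<phi>_def)
    next
      case False
      then have "F (\<phi> x) < F (\<phi> y)" using le \<phi>[of x] \<phi>[of y] by linarith
      then show ?thesis using monoD[OF F(1), of "\<phi> y" "\<phi> x"] by linarith
    qed
  qed
  then have \<phi>_meas[measurable]: "\<phi> \<in> borel_measurable borel" by (rule borel_measurable_mono)
  define q where "q \<tau> = cc (\<phi> \<tau>)" for \<tau>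
  have q_meas[measurable]: "q \<in> borel_measurable borel"
    unfolding q_def by (rule borel_measurable_continuous_on[OF cc_cont \<phi>_meas])
  have kq_meas[measurable]: "(\<lambda>\<tau>. k (q \<tau>)) \<in> borel_measurable borel"
    by (rule borel_measurable_continuous_on[OF k_cont q_meas])
  have q_F: "q (F t) = c t" if "t \<in> {a..b}" for t
    using \<phi>[of "F t"] F_in[OF that] that F_eq[of "\<phi> (F t)" t] by (simp add: q_def cc)
  have g_kq: "g t * k (q (F t)) = g t * K t" for t
    by (cases "t \<in> {a..b}") (auto simp: q_F K_def cc g_outside)
  have q_dist: "ennreal (dist (q x) (q y)) \<le> (\<integral>\<^sup>+\<tau>\<in>{x..y}. k (q \<tau>) \<partial>lborel)"
    if "0 \<le> x" "x \<le> y" "y \<le> T" for x y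
  proof -
    have F_x: "F (\<phi> x) = x" and F_y: "F (\<phi> y) = y" using \<phi>[of x] \<phi>[of y] that by auto
    have "ennreal (dist (q x) (q y)) = ennreal (dist (c (\<phi> x)) (c (\<phi> y)))"
      using \<phi> by (simp add: q_def cc)
    also have "\<dots> \<le> (\<integral>\<^sup>+t\<in>{\<phi> x..\<phi> y}. g t * K t \<partial>lborel)"
      using \<phi> monoD[OF \<open>mono \<phi>\<close> that(2)] by (intro dist_le) auto
    \<comment> \<open>By monotonicity \<open>F\<close> maps \<open>{\<phi> x..\<phi> y}\<close> into
      \<open>{x..y}\<close>, which brings the integrand into the form for the change of
      time.\<close>
    also have "\<dots> \<le> (\<integral>\<^sup>+t. g t * (k (q (F t)) * indicator {x..y} (F t)) \<partial>lborel)"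
    proof (intro nn_integral_mono)
      fix t
      show "g t * K t * indicator {\<phi> x..\<phi> y} t \<le> g t * (k (q (F t)) * indicator {x..y} (F t))"
        using monoD[OF F(1), of "\<phi> x" t] monoD[OF F(1), of t "\<phi> y"] F_x F_y g_kq[of t]
        by (auto split: split_indicator)
    qed
    also have "\<dots> = (\<integral>\<^sup>+\<tau>\<in>{0..T}. k (q \<tau>) * indicator {x..y} \<tau> \<partial>lborel)"
      by (rule F(6)) measurable
    also have "\<dots> \<le> (\<integral>\<^sup>+\<tau>\<in>{x..y}. k (q \<tau>) \<partial>lborel)"
      by (intro nn_integral_mono) (simp split: split_indicator)
    finally show ?thesis .
  qed
  have kq_fin: "(\<integral>\<^sup>+\<tau>\<in>{0..T}. k (q \<tau>) \<partial>lborel) < \<infinity>"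
  proof -
    have "(\<integral>\<^sup>+\<tau>\<in>{0..T}. k (q \<tau>) \<partial>lborel) = (\<integral>\<^sup>+t. g t * k (q (F t)) \<partial>lborel)"
      by (rule F(6)[symmetric]) measurable
    also have "\<dots> = (\<integral>\<^sup>+t. w t \<partial>lborel)"
      unfolding g_kq using Kg by (intro nn_integral_cong_AE, eventually_elim) (simp add: mult.commute)
    finally show ?thesis using w_fin by simp
  qed
  have ac_q: "abs_continuous_on 0 T q"
    using kq_meas kq_fin q_dist by (rule abs_continuous_on_of_nn_integral)
  have q_0: "q 0 = c a" using q_F[of a] F(2) \<open>a < b\<close> by simp
  have q_T: "q T = c b" using q_F[of b] F(3) \<open>a < b\<close> by simp
  \<comment> \<open>With \<open>T = 0\<close> the function \<open>F\<close> would be constant on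
    \<open>{a..b}\<close>, forcing \<open>c t0 = c a\<close>.\<close>
  have "T \<noteq> 0"
  proof
    assume "T = 0"
    then have "F t0 = F a" using F_in[of t0] assms(6) F(2) by auto
    then show False using F_eq[of t0 a] assms by auto
  qed
  then have "0 < T" using T0 by simp
  obtain f' where f': "AE \<tau> in lborel. \<tau> \<in> {0..T} \<longrightarrow> (q has_vector_derivative f' \<tau>) (at \<tau> within {0..T})"
    using abs_continuous_derivative[OF \<open>0 < T\<close> ac_q] by blast
  have kq_cont: "continuous_on {0..T} (\<lambda>\<tau>. k (q \<tau>))"
    by (rule continuous_on_compose2[OF k_cont abs_continuous_on_imp_continuous_on[OF ac_q]]) simp
  have "AE \<tau> in lborel. k (q \<tau>) * indicator {0..T} \<tau> \<noteq> \<infinity>"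
    using kq_fin by (intro nn_integral_noteq_infinite) auto
  \<comment> \<open>The single time \<open>\<tau> = T\<close> is left out because the bound on the
    derivative looks to the right of \<tau>.\<close>
  then have speed: "AE \<tau> in lborel. \<tau> \<in> {0..T} \<longrightarrow>
      k (q \<tau>) < \<infinity> \<and> ennreal (norm (path_velocity 0 T q \<tau>)) \<le> k (q \<tau>)"
    using f' AE_lborel_singleton[of T]
  proof eventually_elim
    case (elim \<tau>)
    show ?case
    proof
      assume \<tau>: "\<tau> \<in> {0..T}"
      with elim have d: "(q has_vector_derivative f' \<tau>) (at \<tau> within {0..T})" by simp
      have "ennreal (norm (f' \<tau>)) \<le> k (q \<tau>)"
        using \<tau> elim by (intro norm_has_vector_derivative_le_of_integral_bound[OF _ _ d kq_cont q_dist]) auto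
      moreover have "path_velocity 0 T q \<tau> = f' \<tau>"
        unfolding path_velocity_def using vector_derivative_within_closed_interval[OF \<open>0 < T\<close> \<tau> d] .
      ultimately show "k (q \<tau>) < \<infinity> \<and> ennreal (norm (path_velocity 0 T q \<tau>)) \<le> k (q \<tau>)"
        using elim \<tau> by (simp add: less_top)
    qed
  qed
  \<comment> \<open>Of the two factors \<open>k\<close>, one cancels against the time density and
    leaves \<open>|c'|\<close>; the other remains as the weight of the length.\<close>
  have "(\<integral>\<^sup>+\<tau>\<in>{0..T}. k (q \<tau>) * k (q \<tau>) \<partial>lborel) = (\<integral>\<^sup>+t. g t * (k (q (F t)) * k (q (F t))) \<partial>lborel)"
    by (rule F(6)[symmetric]) measurable
  also have "\<dots> = (\<integral>\<^sup>+t. K t * w t \<partial>lborel)"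
  proof (rule nn_integral_cong_AE)
    show "AE t in lborel. g t * (k (q (F t)) * k (q (F t))) = K t * w t"
      using Kg
    proof eventually_elim
      case (elim t)
      show ?case
      proof (cases "t \<in> {a..b}")
        case True
        then show ?thesis by (simp add: q_F K_def cc flip: elim) (simp add: ac_simps)
      qed (simp add: g_outside w_def)
    qed
  qed
  finally have action_eq: "(\<integral>\<^sup>+\<tau>\<in>{0..T}. k (q \<tau>) * k (q \<tau>) \<partial>lborel) = (\<integral>\<^sup>+t. K t * w t \<partial>lborel)" .
  have sub: "c ` {a..b} \<subseteq> q ` {0..T}"
  proof
    fix x assume "x \<in> c ` {a..b}"
    then obtain t where "t \<in> {a..b}" "x = c t" by blast
    then show "x \<in> q ` {0..T}" using q_F F_in by (intro image_eqI[of _ _ "F t"]) auto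
  qed
  have "(\<integral>\<^sup>+\<tau>\<in>{0..T}. k (q \<tau>) * k (q \<tau>) \<partial>lborel)
      \<le> (\<integral>\<^sup>+t\<in>{a..b}. k (c t) * ennreal (norm (path_velocity a b c t)) \<partial>lborel)"
    unfolding action_eq length_eq ..
  with \<open>0 < T\<close> ac_q q_0 q_T sub speed show thesis by (rule that)
qed

text \<open>A monotone map with open image is continuous. Here the image is all of
  \<open>ennreal\<close>: a finite \<open>r\<close> comes from its square, and \<open>top\<close>
  comes from \<infinity>.\<close>

lemma continuous_on_sqrt_ereal: "continuous_on {0..} sqrt_ereal"
proof (rule continuous_onI_mono)
  have "y \<in> sqrt_ereal ` {0..}" for y
  proof (cases y rule: ennreal_cases)
    case (real r)
    then have "y = sqrt_ereal (ereal (r\<^sup>2))" by (simp add: sqrt_ereal_def)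
    then show ?thesis by (intro image_eqI[where x = "ereal (r\<^sup>2)"]) auto
  next
    case top
    then have "y = sqrt_ereal \<infinity>" by (simp add: sqrt_ereal_def)
    then show ?thesis by (intro image_eqI[where x = \<infinity>]) auto
  qed
  then have "sqrt_ereal ` {0..} = UNIV" by auto
  then show "open (sqrt_ereal ` {0..})" by simp
  fix x y :: ereal assume "x \<in> {0..}" "y \<in> {0..}" "x \<le> y"
  then show "sqrt_ereal x \<le> sqrt_ereal y"
    by (cases x; cases y) (auto simp: sqrt_ereal_def intro: ennreal_leI)
qed

section \<open>Pointwise comparison of the length integrand at energy 0 with the Lagrangian\<close>

lemma jm_integrand_le_lagrangian:
  assumes "0 < u"
  shows "sqrt_ereal (2 * (ereal 0 + u)) * ennreal \<bar>v\<bar> \<le> ennreal (v\<^sup>2 / 2) + e2ennreal u"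
proof (cases u)
  case (real r)
  then have r: "0 < r" using assms by simp
  have "sqrt (2 * r) * \<bar>v\<bar> \<le> v\<^sup>2 / 2 + r"
  proof -
    have "0 \<le> (\<bar>v\<bar> - sqrt (2 * r))\<^sup>2" by simp
    also have "\<dots> = v\<^sup>2 + 2 * r - 2 * (sqrt (2 * r) * \<bar>v\<bar>)"
      using r by (simp add: power2_diff algebra_simps)
    finally show ?thesis by simp
  qed
  then have "ennreal (sqrt (2 * r)) * ennreal \<bar>v\<bar> \<le> ennreal (v\<^sup>2 / 2) + ennreal r"
    using r by (simp add: ennreal_leI flip: ennreal_mult ennreal_plus)
  then show ?thesis using real by (simp add: sqrt_ereal_def)
qed (use assms in \<open>auto simp: sqrt_ereal_def\<close>)

text \<open>Speed at most \<open>sqrt (2 * u)\<close> keeps the kinetic energy at most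
  \<open>u\<close>, so the Lagrangian is at most \<open>2 * u\<close>, the square of that speed. An
  upper bound on the speed is thus enough to bound the action from above.\<close>

lemma lagrangian_le_of_speed_le:
  assumes "0 < u" "0 \<le> v" "sqrt_ereal (2 * (ereal 0 + u)) < \<infinity>"
    "ennreal v \<le> sqrt_ereal (2 * (ereal 0 + u))"
  shows "ennreal (v\<^sup>2 / 2) + e2ennreal u \<le> sqrt_ereal (2 * (ereal 0 + u)) * sqrt_ereal (2 * (ereal 0 + u))"
proof (cases u)
  case (real r)
  then have r: "0 < r" using assms by simp
  have k: "sqrt_ereal (2 * (ereal 0 + u)) = ennreal (sqrt (2 * r))" using real by (simp add: sqrt_ereal_def)
  then have "v \<le> sqrt (2 * r)" using assms(4) r by (simp add: ennreal_le_iff)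
  then have "v\<^sup>2 \<le> 2 * r" using assms(2) r by (metis real_sqrt_pow2 power_mono less_imp_le mult_pos_pos zero_less_numeral)
  then have "ennreal (v\<^sup>2 / 2) + ennreal r \<le> ennreal (2 * r)"
    using r by (simp add: ennreal_leI flip: ennreal_plus)
  also have "\<dots> = ennreal (sqrt (2 * r)) * ennreal (sqrt (2 * r))"
    using r by (simp flip: ennreal_mult)
  finally show ?thesis unfolding k unfolding real e2ennreal_ereal .
qed (use assms in \<open>auto simp: sqrt_ereal_def\<close>)

lemma jm_length_le_action:
  assumes "\<And>q. 0 < U q"
  shows "jm_length U 0 0 T c \<le> action U T c"
  unfolding jm_length_def action_def
proof (intro nn_integral_mono mult_right_mono)
  fix t
  show "sqrt_ereal (2 * (ereal 0 + U (c t))) * ennreal (norm (path_velocity 0 T c t))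
      \<le> ennreal ((norm (path_velocity 0 T c t))\<^sup>2 / 2) + e2ennreal (U (c t))"
    using jm_integrand_le_lagrangian[OF assms, of "c t" "norm (path_velocity 0 T c t)"] by simp
qed simp

section \<open>Minimizing geodesics of energy 0 as minimizers of the action\<close>

theorem theorem1:
  fixes U V :: "real ^ 'n \<Rightarrow> ereal"
  assumes "U = (\<lambda>q. - V q)"
    and "\<And>q. 0 < U q"
    and "continuous_on UNIV U"
    and "smooth_on {q. \<not> collision_point U q} (\<lambda>q. real_of_ereal (U q))"
    and "marchal_lemma V"
  shows "jm_marchal_lemma V 0"
proof -
  have pos: "0 < U q" for q by (rule assms(2))
  have hill: "hill_region U 0 = UNIV"
    using pos by (auto simp: hill_region_def less_imp_le simp flip: zero_ereal_def)
  \<comment> \<open>The speed at which kinetic energy equals \<open>U\<close>, that is, motion with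
    total energy 0; it is infinite exactly at collisions.\<close>
  define k where "k x = sqrt_ereal (2 * (ereal 0 + U x))" for x
  have k_pos: "0 < k x" for x
    using pos[of x] by (cases "U x") (auto simp: k_def sqrt_ereal_def)
  have k_cont: "continuous_on UNIV k"
    unfolding k_def
  proof (rule continuous_on_compose2[OF continuous_on_sqrt_ereal])
    show "continuous_on UNIV (\<lambda>x. 2 * (ereal 0 + U x))"
      using assms(3) by (auto simp flip: zero_ereal_def intro!: continuous_on_cmult_ereal)
    show "(\<lambda>x. 2 * (ereal 0 + U x)) ` UNIV \<subseteq> {0..}"
      using pos by (auto simp: less_imp_le simp flip: zero_ereal_def)
  qed
  have no_collision: "\<not> interior_collision_point U a b c p"
    if geo: "minimizing_jm_geodesic U 0 a b c" for a b c p
  proof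
    assume p: "interior_collision_point U a b c p"
    have "a < b" and ac: "abs_continuous_on a b c" and fin: "jm_length U 0 a b c < \<infinity>"
      using geo by (auto simp: minimizing_jm_geodesic_def hill_curve_def)
    obtain t0 where t0: "t0 \<in> {a..b}" "p = c t0" and p_ends: "p \<noteq> c a" "p \<noteq> c b"
      and "collision_point U p"
      using p by (auto simp: interior_collision_point_def)
    have length: "jm_length U 0 a b c
        = (\<integral>\<^sup>+t\<in>{a..b}. k (c t) * ennreal (norm (path_velocity a b c t)) \<partial>lborel)"
      by (simp add: jm_length_def k_def)
    \<comment> \<open>An interior collision point differs from the starting point, so the geodesic
      is not constant and its travel time is positive.\<close>
    have "c t0 \<noteq> c a" using t0 p_ends by simp
    then obtain q T where T: "0 < T" and q: "abs_continuous_on 0 T q" "q 0 = c a" "q T = c b"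
      "c ` {a..b} \<subseteq> q ` {0..T}"
      and speed: "AE \<tau> in lborel. \<tau> \<in> {0..T} \<longrightarrow>
        k (q \<tau>) < \<infinity> \<and> ennreal (norm (path_velocity 0 T q \<tau>)) \<le> k (q \<tau>)"
      and kk: "(\<integral>\<^sup>+\<tau>\<in>{0..T}. k (q \<tau>) * k (q \<tau>) \<partial>lborel) \<le> jm_length U 0 a b c"
      unfolding length
      by (rule reparametrization_by_speed[OF \<open>a < b\<close> ac k_cont k_pos fin[unfolded length] t0(1)])
    have "action U T q \<le> (\<integral>\<^sup>+\<tau>\<in>{0..T}. k (q \<tau>) * k (q \<tau>) \<partial>lborel)"
      unfolding action_def
    proof (rule nn_integral_mono_AE)
      show "AE \<tau> in lborel. (ennreal ((norm (path_velocity 0 T q \<tau>))\<^sup>2 / 2) + e2ennreal (U (q \<tau>))) * indicator {0..T} \<tau>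
          \<le> k (q \<tau>) * k (q \<tau>) * indicator {0..T} \<tau>"
        using speed
      proof eventually_elim
        case (elim \<tau>)
        then show ?case
          using lagrangian_le_of_speed_le[OF pos, of "norm (path_velocity 0 T q \<tau>)" "q \<tau>"]
          by (auto simp: k_def split: split_indicator)
      qed
    qed
    with kk have action_q: "action U T q \<le> jm_length U 0 a b c" by (rule order_trans[rotated])
    \<comment> \<open>For a competitor \<sigma> in time \<open>T\<close> the chain is: action of
      \<open>q\<close> \<le> length of \<open>c\<close> \<le> length of \<sigma> \<le> action of
      \<sigma>. With \<open>U\<close> positive the Hill region is the whole space, so \<sigma> is
      admissible for the length problem.\<close>
    have "action_minimizer U T (c a) (c b) q"
      unfolding action_minimizer_def
    proof (intro conjI allI impI)
      show "joins_in_time T (c a) (c b) q" using q by (simp add: joins_in_time_def)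
      show "action U T q < \<infinity>" using action_q fin by (rule le_less_trans)
      fix \<sigma> assume \<sigma>: "joins_in_time T (c a) (c b) \<sigma>"
      have "hill_curve U 0 0 T \<sigma>"
        using \<sigma> T by (simp add: hill_curve_def joins_in_time_def hill)
      then have "jm_length U 0 a b c \<le> jm_length U 0 0 T \<sigma>"
        using geo \<sigma> unfolding minimizing_jm_geodesic_def joins_in_time_def by blast
      also have "\<dots> \<le> action U T \<sigma>" by (rule jm_length_le_action[OF pos])
      finally show "action U T q \<le> action U T \<sigma>" using action_q by (rule order_trans[rotated])
    qed
    \<comment> \<open>The curve \<open>q\<close> has the same endpoints as \<open>c\<close> and
      passes through every point of \<open>c\<close>.\<close>
    moreover have "interior_collision_point U 0 T q p"
      using q t0 p_ends \<open>collision_point U p\<close> by (auto simp: interior_collision_point_def)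
    ultimately show False
      using assms(5) T unfolding marchal_lemma_def Let_def assms(1)[symmetric] by blast
  qed
  then show ?thesis
    unfolding jm_marchal_lemma_def Let_def assms(1)[symmetric] by blast
qed

end
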